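(* Let $1<M<\infty$ and let $\bar{\mathcal P}^2_{\mathsf N}(M)$ be the set of pairs $(\mu,\nu)=\big(\mathcal N(\mathsf m_p,\sigma_p^2\mathrm I_d),\mathcal N(\mathsf m_q,\sigma_q^2\mathrm I_d)\big)$ of isotropic Gaussian measures on $\mathbb R^d$ with $\|\mathsf m_p\|,\|\mathsf m_q\|\le M$ and $\sigma_p^2,\sigma_p^{-2},\sigma_q^2,\sigma_q^{-2}<M$. There exist positive constants $c_{d,M},c',c'',C$ depending only on $d,M$ such that, with $m_k=c'(\log k)^{(d+3)/2}$, $r_k=(1\vee M)+\tilde r_k$, $\tilde r_k=c''\sqrt{\log k}$ and $\mathcal G_k=\hat{\mathcal G}_k^{\mathsf R}(m_k,r_k)$, for all integers $k\ge2$ and $n\ge1$, $$\sup_{(\mu,\nu)\in\bar{\mathcal P}^2_{\mathsf N}(M)}\mathbb E\Big[\big|\hat{\mathsf D}_{\mathcal G_k}(X^n,Y^n)-\mathsf D_{\mathsf{KL}}(\mu\|\nu)\big|\Big]\le C(\log k)^{\frac{d+4}2}\Big(k^{-\frac12}+k^{c_{d,M}(\log k)^{\frac{d+2}2}}\,n^{-\frac12}\Big).$$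
   Context: $\mathsf D_{\mathsf{KL}}(\mu\|\nu)=\mathbb E_\mu[\log\frac{d\mu}{d\nu}]$. Neural networks: $\mathcal G_k(a_1,a_2,a_3,a_4,\phi)$ is the set of $g(x)=\sum_{i=1}^k\beta_i\phi(w_i\cdot x+b_i)+w_0\cdot x+b_0$ on $\mathbb R^d$ with $\|w_i\|_1\vee|b_i|\le a_1$, $|\beta_i|\le a_2$ ($1\le i\le k$), $|b_0|\le a_3$, $\|w_0\|_1\le a_4$; $\phi_{\mathsf R}(z)=\max\{z,0\}$. $B_d(r)$ is the Euclidean ball of radius $r$ centered at $0$, and $\hat{\mathcal G}_k^{\mathsf R}(a,r)=\{g\mathbf 1_{B_d(r)}:g\in\mathcal G_k(1,2k^{-1}a,a,a,\phi_{\mathsf R})\}$. Estimator: $\hat{\mathsf D}_{\mathcal G}(X^n,Y^n)=\sup_{g\in\mathcal G}\frac1n\sum_{i=1}^n\big[g(X_i)-(e^{g(Y_i)}-1)\big]$, where $(X_i)$ are i.i.d. from $\mu$ and $(Y_i)$ i.i.d. from $\nu$ (independent samples). *)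

theory Defs
  imports "HOL-Probability.Probability"
begin

definition isotropic_gaussian :: "real ^ 'n \<Rightarrow> real \<Rightarrow> (real ^ 'n) measure" where
  "isotropic_gaussian m \<sigma> = density lborel (\<lambda>x. ennreal
     (exp (- (norm (x - m))\<^sup>2 / (2 * \<sigma>\<^sup>2)) / (2 * pi * \<sigma>\<^sup>2) powr (real CARD('n) / 2)))"

text \<open>The second parameter of \<^const>\<open>isotropic_gaussian\<close> is the standard deviation. Positivity
  is required explicitly below because the inverse of 0 is 0.\<close>

definition gaussian_pairs :: "real \<Rightarrow> ((real ^ 'n) measure \<times> (real ^ 'n) measure) set" where
  "gaussian_pairs M =
     {(isotropic_gaussian mp \<sigma>p, isotropic_gaussian mq \<sigma>q) | mp \<sigma>p mq \<sigma>q.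
        norm mp \<le> M \<and> norm mq \<le> M \<and> 0 < \<sigma>p \<and> 0 < \<sigma>q \<and>
        \<sigma>p\<^sup>2 < M \<and> inverse (\<sigma>p\<^sup>2) < M \<and> \<sigma>q\<^sup>2 < M \<and> inverse (\<sigma>q\<^sup>2) < M}"

text \<open>The library's KL divergence takes the reference measure first and integrates against the
  second measure; base \<^term>\<open>exp 1\<close> gives the natural logarithm.\<close>

definition KL :: "'a measure \<Rightarrow> 'a measure \<Rightarrow> real" where
  "KL \<mu> \<nu> = KL_divergence (exp 1) \<nu> \<mu>"

definition l1_norm :: "real ^ 'n \<Rightarrow> real" where
  "l1_norm w = (\<Sum>j\<in>UNIV. \<bar>w $ j\<bar>)"

definition relu :: "real \<Rightarrow> real" where
  "relu z = max z 0"

definition neural_nets ::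
  "nat \<Rightarrow> real \<Rightarrow> real \<Rightarrow> real \<Rightarrow> real \<Rightarrow> (real \<Rightarrow> real) \<Rightarrow> (real ^ 'n \<Rightarrow> real) set" where
  "neural_nets k a1 a2 a3 a4 \<phi> =
     {(\<lambda>x. (\<Sum>i=1..k. \<beta> i * \<phi> (w i \<bullet> x + b i)) + w 0 \<bullet> x + b 0) | \<beta> w b.
        (\<forall>i\<in>{1..k}. max (l1_norm (w i)) \<bar>b i\<bar> \<le> a1 \<and> \<bar>\<beta> i\<bar> \<le> a2) \<and>
        \<bar>b 0\<bar> \<le> a3 \<and> l1_norm (w 0) \<le> a4}"

definition truncated_relu_nets :: "nat \<Rightarrow> real \<Rightarrow> real \<Rightarrow> (real ^ 'n \<Rightarrow> real) set" where
  "truncated_relu_nets k a r =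
     {(\<lambda>x. g x * indicator (cball 0 r) x) | g. g \<in> neural_nets k 1 (2 * inverse (real k) * a) a a relu}"

definition KL_estimator ::
  "('a \<Rightarrow> real) set \<Rightarrow> nat \<Rightarrow> (nat \<Rightarrow> 'a) \<Rightarrow> (nat \<Rightarrow> 'a) \<Rightarrow> real" where
  "KL_estimator G n X Y =
     (SUP g\<in>G. (1 / real n) * (\<Sum>i=1..n. g (X i) - (exp (g (Y i)) - 1)))"

text \<open>Joint law of two independent i.i.d. samples of size \<open>n\<close>, from \<open>\<mu>\<close> and from \<open>\<nu>\<close>.\<close>

definition sample_law :: "nat \<Rightarrow> 'a measure \<Rightarrow> 'a measure \<Rightarrow> ((nat \<Rightarrow> 'a) \<times> (nat \<Rightarrow> 'a)) measure" where
  "sample_law n \<mu> \<nu> = (\<Pi>\<^sub>M i\<in>{1..n}. \<mu>) \<Otimes>\<^sub>M (\<Pi>\<^sub>M i\<in>{1..n}. \<nu>)"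


text \<open>Well-posedness: the Gaussians are probability measures, the supremum in the estimator is over
  a nonempty bounded set of reals, and the estimator is measurable, so that the Lebesgue integral
  of its absolute error is its expectation.\<close>

lemma prob_space_isotropic_gaussian:
  fixes m :: "real ^ 'n"
  assumes "0 < \<sigma>"
  shows "prob_space (isotropic_gaussian m \<sigma>)"
proof
  have pw: "(2 * pi * \<sigma>\<^sup>2) powr (real CARD('n) / 2) = sqrt (2 * pi * \<sigma>\<^sup>2) ^ CARD('n)"
  proof -
    have "(2 * pi * \<sigma>\<^sup>2) powr (real CARD('n) / 2) = ((2 * pi * \<sigma>\<^sup>2) powr (1 / 2)) powr real CARD('n)"
      by (simp add: powr_powr)
    also have "\<dots> = sqrt (2 * pi * \<sigma>\<^sup>2) powr real CARD('n)"
      by (simp only: powr_half_sqrt [of "2 * pi * \<sigma>\<^sup>2"] zero_le_power2 pi_ge_zero mult_nonneg_nonneg zero_le_numeral)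
    also have "\<dots> = sqrt (2 * pi * \<sigma>\<^sup>2) ^ CARD('n)"
      using assms by (intro powr_realpow) simp
    finally show ?thesis .
  qed
  have eq: "exp (- (norm (x - m))\<^sup>2 / (2 * \<sigma>\<^sup>2)) / (2 * pi * \<sigma>\<^sup>2) powr (real CARD('n) / 2)
     = (\<Prod>b\<in>Basis. normal_density (m \<bullet> b) \<sigma> (x \<bullet> b))" for x
  proof -
    have "(norm (x - m))\<^sup>2 = (\<Sum>b\<in>Basis. (x \<bullet> b - m \<bullet> b)\<^sup>2)"
      unfolding power2_norm_eq_inner
      by (subst euclidean_inner) (simp add: inner_diff_left power2_eq_square)
    then have "exp (- (norm (x - m))\<^sup>2 / (2 * \<sigma>\<^sup>2))
        = (\<Prod>b\<in>Basis. exp (- (x \<bullet> b - m \<bullet> b)\<^sup>2 / (2 * \<sigma>\<^sup>2)))"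
      by (simp only: exp_sum [OF finite_Basis, symmetric] sum_divide_distrib [symmetric] sum_negf)
    then show ?thesis
      unfolding pw normal_density_def prod.distrib by (simp only: prod_constant DIM_cart) (simp add: power_divide)
  qed
  have "emeasure (isotropic_gaussian m \<sigma>) (space (isotropic_gaussian m \<sigma>))
      = (\<integral>\<^sup>+x. (\<Prod>b\<in>Basis. ennreal (normal_density (m \<bullet> b) \<sigma> (x \<bullet> b))) \<partial>lborel)"
    unfolding isotropic_gaussian_def eq
    by (subst emeasure_density) (auto simp: prod_ennreal intro!: borel_measurable_continuous_onI)
  also have "\<dots> = (\<Prod>b\<in>Basis. (\<integral>\<^sup>+x. ennreal (normal_density (m \<bullet> b) \<sigma> x) \<partial>lborel))"
    by (rule nn_integral_lborel_prod) auto
  also have "\<dots> = 1"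
    using assms by (simp add: nn_integral_eq_integral)
  finally show "emeasure (isotropic_gaussian m \<sigma>) (space (isotropic_gaussian m \<sigma>)) = 1" .
qed

lemma neural_nets_relu_continuous:
  "g \<in> neural_nets k a1 a2 a3 a4 relu \<Longrightarrow> continuous_on UNIV g"
  unfolding neural_nets_def relu_def by (auto intro!: continuous_intros)

lemma abs_inner_le_l1_norm: "\<bar>w \<bullet> x\<bar> \<le> l1_norm w * norm x"
proof -
  have "\<bar>w \<bullet> x\<bar> \<le> (\<Sum>j\<in>UNIV. \<bar>w $ j * x $ j\<bar>)"
    unfolding inner_vec_def by (simp add: sum_abs)
  also have "\<dots> \<le> (\<Sum>j\<in>UNIV. \<bar>w $ j\<bar> * norm x)"
    by (intro sum_mono) (simp add: abs_mult component_le_norm_cart mult_left_mono)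
  finally show ?thesis by (simp add: l1_norm_def sum_distrib_right)
qed

lemma neural_nets_relu_bounded:
  assumes "g \<in> neural_nets k 1 a2 a3 a4 relu"
  shows "\<bar>g x\<bar> \<le> real k * (\<bar>a2\<bar> * (norm x + 1)) + a4 * norm x + a3"
proof -
  from assms obtain \<beta> w b where
    g: "g = (\<lambda>x. (\<Sum>i=1..k. \<beta> i * relu (w i \<bullet> x + b i)) + w 0 \<bullet> x + b 0)"
    and wb: "\<And>i. i \<in> {1..k} \<Longrightarrow> l1_norm (w i) \<le> 1 \<and> \<bar>b i\<bar> \<le> 1 \<and> \<bar>\<beta> i\<bar> \<le> a2"
    and wb0: "\<bar>b 0\<bar> \<le> a3" "l1_norm (w 0) \<le> a4"
    unfolding neural_nets_def by fastforce
  have in_le: "\<bar>v \<bullet> x\<bar> \<le> c * norm x" if "l1_norm v \<le> c" for v c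
    using abs_inner_le_l1_norm [of v x] mult_right_mono [OF that norm_ge_zero [of x]] by linarith
  have "\<bar>\<beta> i * relu (w i \<bullet> x + b i)\<bar> \<le> \<bar>a2\<bar> * (norm x + 1)" if "i \<in> {1..k}" for i
  proof -
    have "\<bar>relu (w i \<bullet> x + b i)\<bar> \<le> norm x + 1"
      using wb [OF that] in_le [of "w i" 1] by (auto simp: relu_def)
    then show ?thesis
      using wb [OF that] by (auto simp: abs_mult intro!: mult_mono)
  qed
  then have "\<bar>\<Sum>i=1..k. \<beta> i * relu (w i \<bullet> x + b i)\<bar> \<le> (\<Sum>i=1..k. \<bar>a2\<bar> * (norm x + 1))"
    by (intro order_trans [OF sum_abs] sum_mono) auto
  then show ?thesis
    unfolding g using wb0 in_le [OF wb0(2)] by simp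
qed

lemma truncated_relu_nets_nonempty:
  assumes "0 \<le> a"
  shows "truncated_relu_nets k a r \<noteq> {}"
proof -
  have "(\<lambda>x. (\<Sum>i=1..k. 0 * relu (0 \<bullet> x + 0)) + 0 \<bullet> x + 0)
      \<in> neural_nets k 1 (2 * inverse (real k) * a) a a relu"
    unfolding neural_nets_def mem_Collect_eq
    using assms by (intro exI [of _ "\<lambda>_. 0"]) (auto simp: l1_norm_def)
  then show ?thesis unfolding truncated_relu_nets_def by blast
qed

lemma KL_estimator_bdd_above:
  "bdd_above ((\<lambda>g. (1 / real n) * (\<Sum>i=1..n. g (X i) - (exp (g (Y i)) - 1)))
     ` truncated_relu_nets k a r)"
proof -
  define B where "B x = real k * (\<bar>2 * inverse (real k) * a\<bar> * (norm x + 1)) + \<bar>a\<bar> * norm x + \<bar>a\<bar>"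
    for x :: "real ^ 'a"
  have g: "g x \<le> B x" if "g \<in> truncated_relu_nets k a r" for g x
  proof -
    from that obtain h where h: "h \<in> neural_nets k 1 (2 * inverse (real k) * a) a a relu"
      and gh: "g = (\<lambda>x. h x * indicator (cball 0 r) x)"
      unfolding truncated_relu_nets_def by auto
    have "\<bar>h x\<bar> \<le> B x"
      using neural_nets_relu_bounded [OF h, of x] mult_right_mono [OF abs_ge_self [of a], of "norm x"]
      by (simp add: B_def)
    moreover have "0 \<le> B x" unfolding B_def by simp
    ultimately show ?thesis by (auto simp: gh indicator_def)
  qed
  show ?thesis
  proof (rule bdd_aboveI2)
    fix g :: "real ^ 'a \<Rightarrow> real" assume G: "g \<in> truncated_relu_nets k a r"
    have "g (X i) - (exp (g (Y i)) - 1) \<le> B (X i) + 1" for i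
      using g [OF G, of "X i"] exp_ge_zero [of "g (Y i)"] by linarith
    then show "(1 / real n) * (\<Sum>i=1..n. g (X i) - (exp (g (Y i)) - 1))
        \<le> (1 / real n) * (\<Sum>i=1..n. B (X i) + 1)"
      by (intro mult_left_mono sum_mono) auto
  qed
qed

lemma KL_estimator_measurable:
  assumes "sets \<mu> = sets borel" "sets \<nu> = sets borel" "0 \<le> a"
  shows "(\<lambda>(X, Y). KL_estimator (truncated_relu_nets k a r) n X Y)
    \<in> borel_measurable (sample_law n \<mu> (\<nu> :: (real ^ 'n) measure))"
proof -
  let ?N = "neural_nets k 1 (2 * inverse (real k) * a) a a relu :: (real ^ 'n \<Rightarrow> real) set"
  let ?G = "truncated_relu_nets k a r :: (real ^ 'n \<Rightarrow> real) set"
  let ?B = "cball 0 r :: (real ^ 'n) set"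
  let ?\<Omega> = "borel :: ((nat \<Rightarrow> real ^ 'n) \<times> (nat \<Rightarrow> real ^ 'n)) measure"
  define F where "F S T h p = (1 / real n) * (\<Sum>i=1..n. (if i \<in> S then h (fst p i) else 0)
      - (exp (if i \<in> T then h (snd p i) else 0) - 1))"
    for S T :: "nat set" and h :: "real ^ 'n \<Rightarrow> real" and p :: "(nat \<Rightarrow> real ^ 'n) \<times> (nat \<Rightarrow> real ^ 'n)"
  define A where "A S T = {p. (\<forall>i\<in>{1..n}. fst p i \<in> ?B \<longleftrightarrow> i \<in> S) \<and> (\<forall>i\<in>{1..n}. snd p i \<in> ?B \<longleftrightarrow> i \<in> T)}"
    for S T :: "nat set"
  have coord_fst: "continuous_on UNIV (\<lambda>p :: (nat \<Rightarrow> real ^ 'n) \<times> (nat \<Rightarrow> real ^ 'n). fst p i)" for i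
    by (rule continuous_on_product_then_coordinatewise) (intro continuous_intros)
  have coord_snd: "continuous_on UNIV (\<lambda>p :: (nat \<Rightarrow> real ^ 'n) \<times> (nat \<Rightarrow> real ^ 'n). snd p i)" for i
    by (rule continuous_on_product_then_coordinatewise) (intro continuous_intros)
  have iff: "{p. fst p i \<in> ?B \<longleftrightarrow> Q} \<in> sets ?\<Omega>" "{p. snd p i \<in> ?B \<longleftrightarrow> Q} \<in> sets ?\<Omega>" for i Q
  proof -
    have "closed {p :: (nat \<Rightarrow> real ^ 'n) \<times> (nat \<Rightarrow> real ^ 'n). norm (fst p i) \<le> r}"
      "closed {p :: (nat \<Rightarrow> real ^ 'n) \<times> (nat \<Rightarrow> real ^ 'n). norm (snd p i) \<le> r}"
      by (intro closed_Collect_le continuous_intros coord_fst coord_snd)+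
    then have "{p. fst p i \<in> ?B} \<in> sets ?\<Omega>" "{p. snd p i \<in> ?B} \<in> sets ?\<Omega>"
      by (simp_all add: borel_closed)
    then show "{p. fst p i \<in> ?B \<longleftrightarrow> Q} \<in> sets ?\<Omega>" "{p. snd p i \<in> ?B \<longleftrightarrow> Q} \<in> sets ?\<Omega>"
      using sets.compl_sets [of "{p. fst p i \<in> ?B}" ?\<Omega>] sets.compl_sets [of "{p. snd p i \<in> ?B}" ?\<Omega>]
      by (cases Q; simp add: set_diff_eq)+
  qed
  have A: "A S T \<in> sets ?\<Omega>" for S T
  proof -
    have "{p \<in> space ?\<Omega>. \<forall>i\<in>{1..n}. fst p i \<in> ?B \<longleftrightarrow> i \<in> S} \<in> sets ?\<Omega>"
      "{p \<in> space ?\<Omega>. \<forall>i\<in>{1..n}. snd p i \<in> ?B \<longleftrightarrow> i \<in> T} \<in> sets ?\<Omega>"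
      by (rule sets.sets_Collect_finite_All; use iff in simp)+
    from sets.Int [OF this] show ?thesis
      by (simp add: A_def Collect_conj_eq)
  qed
  have F: "open {p. c < F S T h p}" if "h \<in> ?N" for c S T h
  proof -
    have h: "continuous_on UNIV (\<lambda>p :: (nat \<Rightarrow> real ^ 'n) \<times> (nat \<Rightarrow> real ^ 'n). h (fst p i))"
      "continuous_on UNIV (\<lambda>p :: (nat \<Rightarrow> real ^ 'n) \<times> (nat \<Rightarrow> real ^ 'n). h (snd p i))" for i
      by (rule continuous_on_compose2 [OF neural_nets_relu_continuous [OF that]];
          simp add: coord_fst coord_snd)+
    have "continuous_on UNIV (\<lambda>p. (if i \<in> S then h (fst p i) else 0)
        - (exp (if i \<in> T then h (snd p i) else 0) - 1))" for i
      by (cases "i \<in> S"; cases "i \<in> T"; simp; intro continuous_intros h)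
    then have "continuous_on UNIV (F S T h)"
      unfolding F_def by (intro continuous_on_mult_left continuous_on_sum)
    then show ?thesis by (intro open_Collect_less continuous_intros)
  qed
  have F_eq: "F S T h p = (1 / real n) * (\<Sum>i=1..n. g (fst p i) - (exp (g (snd p i)) - 1))"
    if "p \<in> A S T" "g = (\<lambda>x. h x * indicator ?B x)" for S T h g p
    unfolding F_def that(2)
    using that(1) by (intro arg_cong2 [of _ _ _ _ "(*)"] sum.cong) (auto simp: A_def indicator_def)
  have "(\<lambda>p. KL_estimator ?G n (fst p) (snd p)) \<in> borel_measurable ?\<Omega>"
  proof (subst borel_measurable_iff_greater, intro allI)
    fix c
    have "{p :: (nat \<Rightarrow> real ^ 'n) \<times> (nat \<Rightarrow> real ^ 'n). c < KL_estimator ?G n (fst p) (snd p)}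
        = (\<Union>S\<in>Pow {1..n}. \<Union>T\<in>Pow {1..n}. A S T \<inter> (\<Union>h\<in>?N. {p. c < F S T h p}))"
      (is "?L = ?R")
    proof (intro set_eqI)
      fix p :: "(nat \<Rightarrow> real ^ 'n) \<times> (nat \<Rightarrow> real ^ 'n)"
      define S where "S = {i\<in>{1..n}. fst p i \<in> ?B}"
      define T where "T = {i\<in>{1..n}. snd p i \<in> ?B}"
      have pST: "p \<in> A S T" by (auto simp: A_def S_def T_def)
      have "p \<in> ?L \<longleftrightarrow> (\<exists>g\<in>?G. c < (1 / real n) * (\<Sum>i=1..n. g (fst p i) - (exp (g (snd p i)) - 1)))"
        unfolding KL_estimator_def mem_Collect_eq
        by (rule less_cSUP_iff [OF truncated_relu_nets_nonempty [OF assms(3)] KL_estimator_bdd_above])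
      also have "\<dots> \<longleftrightarrow> (\<exists>h\<in>?N. c < (1 / real n) * (\<Sum>i=1..n. h (fst p i) * indicator ?B (fst p i)
          - (exp (h (snd p i) * indicator ?B (snd p i)) - 1)))"
        unfolding truncated_relu_nets_def Setcompr_eq_image by simp
      also have "\<dots> \<longleftrightarrow> p \<in> ?R"
      proof
        assume "\<exists>h\<in>?N. c < (1 / real n) * (\<Sum>i=1..n. h (fst p i) * indicator ?B (fst p i)
          - (exp (h (snd p i) * indicator ?B (snd p i)) - 1))"
        then obtain h where "h \<in> ?N" "c < F S T h p"
          using F_eq [OF pST refl] by auto
        moreover have "S \<in> Pow {1..n}" "T \<in> Pow {1..n}" by (auto simp: S_def T_def)
        ultimately show "p \<in> ?R" using pST by blast
      next
        assume "p \<in> ?R"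
        then obtain S' T' h where "p \<in> A S' T'" "h \<in> ?N" "c < F S' T' h p" by blast
        then show "\<exists>h\<in>?N. c < (1 / real n) * (\<Sum>i=1..n. h (fst p i) * indicator ?B (fst p i)
          - (exp (h (snd p i) * indicator ?B (snd p i)) - 1))"
          using F_eq [OF _ refl] by auto
      qed
      finally show "p \<in> ?L \<longleftrightarrow> p \<in> ?R" .
    qed
    moreover have "?R \<in> sets ?\<Omega>"
    proof -
      have "(\<Union>h\<in>?N. {p. c < F S T h p}) \<in> sets ?\<Omega>" for S T
        by (intro borel_open open_UN ballI F)
      then show ?thesis
        by (intro sets.finite_UN; simp add: A sets.Int)+
    qed
    ultimately show "{p \<in> space ?\<Omega>. c < KL_estimator ?G n (fst p) (snd p)} \<in> sets ?\<Omega>" by simp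
  qed
  moreover have "(\<lambda>p. p) \<in> measurable (sample_law n \<mu> \<nu>) ?\<Omega>"
  proof -
    have coord: "(\<lambda>X. X i) \<in> borel_measurable (\<Pi>\<^sub>M i\<in>{1..n}. \<rho>)"
      if "sets \<rho> = sets borel" for i and \<rho> :: "(real ^ 'n) measure"
    proof (cases "i \<in> {1..n}")
      case True
      then show ?thesis
        using measurable_component_singleton [OF True, of "\<lambda>_. \<rho>"] that
        by (simp cong: measurable_cong_sets)
    next
      case False
      have "X i = undefined" if "X \<in> space (\<Pi>\<^sub>M i\<in>{1..n}. \<rho>)" for X
        using that False by (auto simp: space_PiM PiE_def extensional_def)
      then show ?thesis by (subst measurable_cong [of _ _ "\<lambda>_. undefined"]) auto
    qed
    have "(\<lambda>X. X) \<in> borel_measurable (\<Pi>\<^sub>M i\<in>{1..n}. \<rho>)"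
      if "sets \<rho> = sets borel" for \<rho> :: "(real ^ 'n) measure"
      by (rule measurable_coordinatewise_then_product) (rule coord [OF that])
    from measurable_compose [OF measurable_fst this [OF assms(1)]]
      measurable_compose [OF measurable_snd this [OF assms(2)]]
    have "(\<lambda>p. (fst p, snd p)) \<in> measurable (sample_law n \<mu> \<nu>) (borel \<Otimes>\<^sub>M borel)"
      unfolding sample_law_def by (rule measurable_Pair)
    then show ?thesis by (simp add: borel_prod)
  qed
  ultimately show ?thesis
    unfolding case_prod_beta by (rule measurable_compose [rotated])
qed

end

theory Submission
  imports Defs
begin

text \<open>
  Write \<open>J g = E\<^sub>\<mu> g - E\<^sub>\<nu> (exp g - 1)\<close> for the population version of the quantity that the
  estimator maximises, and \<open>f = ln (d\<mu>/d\<nu>)\<close>. Since \<open>exp u \<ge> 1 + u\<close>, no bounded \<open>g\<close> has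
  \<open>J g\<close> above the divergence, and \<open>J g\<close> is close to the divergence as soon as \<open>g\<close> is close to
  \<open>f\<close> where the mass is. Hence the error of the estimator is at most the gap
  \<open>KL - J g\<^sub>0\<close> of one good network \<open>g\<^sub>0\<close> (bias) plus the supremum over all networks of the
  difference between \<open>J\<close> and its empirical version (deviation).

  \<^bold>\<open>Bias.\<close> For two isotropic Gaussians \<open>f\<close> is a quadratic polynomial
  \<open>\<alpha> \<bar>x\<bar>\<^sup>2 + v \<bullet> x + \<kappa>\<close> with coefficients bounded in terms of \<open>d\<close> and \<open>M\<close>, and
  the square of each coordinate is approximated by a Riemann sum of ReLU ridge functions:
  \<open>k\<close> neurons give a uniform error of order \<open>R\<^sup>2 / k\<close> on the ball of radius \<open>R\<close>
  (\<open>quadratic_relu_approx\<close>). Outside that ball the network is 0, which costs a Gaussian tail;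
  for \<open>R = M + sqrt (2 M ln k)\<close> the tail is of order \<open>k powr (- 1/2)\<close> (\<open>gauss_tail_integral\<close>).

  \<^bold>\<open>Deviation.\<close> On the ball, a network depends on \<open>O(k)\<close> parameters in \<open>[-1, 1]\<close> and is Lipschitz in
  them with a constant \<open>\<Lambda>\<close> of order \<open>(ln k) powr ((d + 4) / 2)\<close>, which also bounds its values
  (\<open>box_net_diff\<close>). Rounding the parameters to dyadic grids gives covers whose logarithmic
  cardinality grows linearly in the level, and chaining along these grids with the
  Hoeffding bound yields a deviation of order \<open>\<Lambda> exp \<Lambda> sqrt (k / n)\<close> (\<open>dyadic_chaining\<close>,
  \<open>lipschitz_net_deviation\<close>), where \<open>exp \<Lambda>\<close> is the Lipschitz constant of the exponential on
  \<open>[-\<Lambda>, \<Lambda>]\<close>. As \<open>k powr (c * (ln k) powr ((d + 2) / 2)) = exp (c * (ln k) powr ((d + 4) / 2))\<close>, a large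
  \<open>c\<close> absorbs all of these factors (\<open>gauss_risk_rate\<close>).

  Each deviation is dominated pointwise, for all networks at once, by an explicit measurable function
  \<open>W\<close>, so that the expectations taken are those of finite sums and not of suprema.
\<close>

section \<open>A maximal inequality for empirical means\<close>

definition empirical_mean :: "nat \<Rightarrow> ('a \<Rightarrow> real) \<Rightarrow> (nat \<Rightarrow> 'a) \<Rightarrow> real" where
  "empirical_mean n f X = (1 / real n) * (\<Sum>i=1..n. f (X i))"

lemma (in prob_space) integrable_bounded:
  assumes "f \<in> borel_measurable M" "\<And>x. x \<in> space M \<Longrightarrow> \<bar>f x\<bar> \<le> (c::real)"
  shows "integrable M f"
  using assms by (intro integrable_const_bound[of _ c]) auto

lemma (in prob_space) expectation_bounded:
  assumes "f \<in> borel_measurable M" "\<And>x. x \<in> space M \<Longrightarrow> \<bar>f x\<bar> \<le> (c::real)"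
  shows "\<bar>expectation f\<bar> \<le> c"
proof -
  have "\<bar>expectation f\<bar> \<le> expectation (\<lambda>x. \<bar>f x\<bar>)" by simp
  also have "\<dots> \<le> expectation (\<lambda>x. c)"
    using integrable_bounded[OF assms] assms(2) by (intro integral_mono) auto
  finally show ?thesis by (simp add: prob_space)
qed

text \<open>The exponential of \<open>l\<close> times the empirical mean is a product over the independent coordinates, and Hoeffding's
  lemma bounds each factor.\<close>

lemma (in prob_space) empirical_mean_mgf:
  assumes f: "f \<in> borel_measurable M" and bd: "\<And>x. x \<in> space M \<Longrightarrow> \<bar>f x\<bar> \<le> (c::real)"
    and n: "1 \<le> n" and l: "0 < l"
  shows "integrable (\<Pi>\<^sub>M i\<in>{1..n}. M) (\<lambda>X. exp (l * (empirical_mean n f X - expectation f)))"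
    and "(\<integral>X. exp (l * (empirical_mean n f X - expectation f)) \<partial>(\<Pi>\<^sub>M i\<in>{1..n}. M)) \<le> exp (l\<^sup>2 * c\<^sup>2 / (2 * real n))"
proof -
  interpret P: product_prob_space "\<lambda>_::nat. M" ..
  define h where "h x = exp ((l / real n) * (f x - expectation f))" for x
  have c0: "0 \<le> c" using bd not_empty by (metis abs_ge_zero all_not_in_conv order_trans)
  have ef: "\<bar>expectation f\<bar> \<le> c" by (rule expectation_bounded[OF f bd])
  have hm: "h \<in> borel_measurable M" unfolding h_def using f by measurable
  have ih: "integrable M h"
  proof (rule integrable_bounded[OF hm])
    fix x assume "x \<in> space M"
    then have "(l / real n) * (f x - expectation f) \<le> (l / real n) * (c + c)"
      using bd[of x] ef l by (intro mult_left_mono) auto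
    then show "\<bar>h x\<bar> \<le> exp ((l / real n) * (c + c))" unfolding h_def by simp
  qed
  have eq: "exp (l * (empirical_mean n f X - expectation f)) = (\<Prod>i\<in>{1..n}. h (X i))" for X
  proof -
    have "(\<Prod>i\<in>{1..n}. h (X i)) = exp (\<Sum>i=1..n. (l / real n) * (f (X i) - expectation f))"
      unfolding h_def by (simp add: exp_sum)
    also have "(\<Sum>i=1..n. (l / real n) * (f (X i) - expectation f))
      = (l / real n) * ((\<Sum>i=1..n. f (X i)) - real n * expectation f)"
      by (subst sum_distrib_left[symmetric]) (simp add: sum_subtractf)
    also have "\<dots> = l * (empirical_mean n f X - expectation f)"
      using n by (simp add: empirical_mean_def field_simps)
    finally show ?thesis by simp
  qed
  show "integrable (\<Pi>\<^sub>M i\<in>{1..n}. M) (\<lambda>X. exp (l * (empirical_mean n f X - expectation f)))"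
    unfolding eq by (rule P.product_integrable_prod) (auto intro: ih)
  have hb: "expectation h \<le> exp ((l / real n)\<^sup>2 * (2 * c)\<^sup>2 / 8)"
  proof -
    interpret I: interval_bounded_random_variable M f "- c" c
    proof
      show "random_variable borel f" by fact
      show "AE x in M. f x \<in> {-c..c}" using bd by (intro AE_I2) (force simp: abs_le_iff)
    qed
    have "ennreal (expectation h) = (\<integral>\<^sup>+ x. ennreal (h x) \<partial>M)"
      using ih by (intro nn_integral_eq_integral[symmetric]) (auto simp: h_def)
    also have "\<dots> \<le> ennreal (exp ((l / real n)\<^sup>2 * (c - - c)\<^sup>2 / 8))"
      unfolding h_def using l n by (intro I.Hoeffdings_lemma_nn_integral) auto
    finally show ?thesis by simp
  qed
  have h0: "0 \<le> expectation h" unfolding h_def by simp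
  have "(\<integral>X. exp (l * (empirical_mean n f X - expectation f)) \<partial>(\<Pi>\<^sub>M i\<in>{1..n}. M)) = expectation h ^ n"
    unfolding eq by (subst P.product_integral_prod) (auto intro: ih)
  also have "\<dots> \<le> exp ((l / real n)\<^sup>2 * (2 * c)\<^sup>2 / 8) ^ n"
    using hb h0 by (intro power_mono) auto
  also have "\<dots> = exp (real n * ((l / real n)\<^sup>2 * (2 * c)\<^sup>2 / 8))"
    by (rule exp_of_nat_mult[symmetric])
  also have "real n * ((l / real n)\<^sup>2 * (2 * c)\<^sup>2 / 8) = l\<^sup>2 * c\<^sup>2 / (2 * real n)"
    using n by (simp add: field_simps power2_eq_square)
  finally show "(\<integral>X. exp (l * (empirical_mean n f X - expectation f)) \<partial>(\<Pi>\<^sub>M i\<in>{1..n}. M)) \<le> exp (l\<^sup>2 * c\<^sup>2 / (2 * real n))" .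
qed

text \<open>The maximum is replaced by a soft maximum, which is measurable and has an explicit expectation:
  \<open>l * W\<close> is the tangent of \<open>ln\<close> at \<open>A\<close>, evaluated at the sum of all \<open>exp (\<plusminus> l Z\<^sub>f)\<close>. \<open>W\<close> dominates the
  maximum because a concave function lies below its tangents, and the expectation of \<open>W\<close> is at most
  \<open>(ln A) / l\<close> since that of the sum is at most \<open>A\<close>.\<close>

lemma (in prob_space) subgaussian_maximal_inequality:
  assumes F: "finite F" "F \<noteq> {}" and q: "ln (2 * real (card F)) \<le> q"
    and m: "\<And>f. f \<in> F \<Longrightarrow> f \<in> borel_measurable M"
    and bd: "\<And>f x. f \<in> F \<Longrightarrow> x \<in> space M \<Longrightarrow> \<bar>f x\<bar> \<le> (c::real)" and c: "0 < c"
    and n: "1 \<le> n"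
  obtains W where "W \<in> borel_measurable (\<Pi>\<^sub>M i\<in>{1..n}. M)" "\<And>X. 0 \<le> W X"
    "\<And>X f. f \<in> F \<Longrightarrow> \<bar>empirical_mean n f X - expectation f\<bar> \<le> W X"
    "(\<integral>\<^sup>+X. ennreal (W X) \<partial>(\<Pi>\<^sub>M i\<in>{1..n}. M)) \<le> ennreal (c * sqrt (2 * q / real n))"
proof -
  let ?P = "\<Pi>\<^sub>M i\<in>{1..n}. M"
  interpret P: product_prob_space "\<lambda>_::nat. M" ..
  interpret PP: prob_space ?P by (rule prob_space_PiM) unfold_locales
  have cF: "1 \<le> card F" using F by (simp add: Suc_leI card_gt_0_iff)
  have "ln 2 \<le> ln (2 * real (card F))" using cF by simp
  then have q0: "0 < q" using q ln_gt_zero[of "2::real"] by linarith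
  \<comment> \<open>the value of \<open>l\<close> at which the two terms \<open>q / l\<close> and
    \<open>l * c\<^sup>2 / (2 * n)\<close> of the final bound are equal\<close>
  define l where "l = sqrt (2 * real n * q) / c"
  have l: "0 < l" using q0 n c by (simp add: l_def)
  define v where "v = l\<^sup>2 * c\<^sup>2 / (2 * real n)"
  \<comment> \<open>an upper bound for the expectation of the sum \<open>S\<close> below\<close>
  define A where "A = 2 * real (card F) * exp v"
  have A: "0 < A" using cF by (simp add: A_def)
  define Z where "Z f X = empirical_mean n f X - expectation f" for f X
  define S where "S X = (\<Sum>f\<in>F. exp (l * Z f X) + exp (l * (- Z f X)))" for X
  define W where "W X = (1 / l) * (ln A - 1 + S X / A)" for X
  have tan: "ln y \<le> ln A - 1 + y / A" if "0 < y" for y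
    using ln_le_minus_one[of "y / A"] A that by (simp add: ln_div)
  have S_ge: "exp (l * \<bar>Z f X\<bar>) \<le> S X" if "f \<in> F" for f X
  proof -
    have "exp (l * \<bar>Z f X\<bar>) \<le> exp (l * Z f X) + exp (l * (- Z f X))"
      by (cases "Z f X \<ge> 0") (auto simp: abs_if)
    also have "\<dots> \<le> S X" unfolding S_def
      using that F by (intro member_le_sum[where f = "\<lambda>f. exp (l * Z f X) + exp (l * (- Z f X))"]) (auto intro!: add_nonneg_nonneg)
    finally show ?thesis .
  qed
  have W_ge: "\<bar>Z f X\<bar> \<le> W X" if "f \<in> F" for f X
  proof -
    have S0: "0 < S X" using S_ge[OF that, of X] exp_gt_zero[of "l * \<bar>Z f X\<bar>"] by linarith
    have "l * \<bar>Z f X\<bar> \<le> ln (S X)" using S_ge[OF that, of X] S0 by (simp add: ln_ge_iff)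
    also have "\<dots> \<le> l * W X" using tan[OF S0] l by (simp add: W_def)
    finally show ?thesis using l by simp
  qed
  have neg: "empirical_mean n (\<lambda>x. - f x) X - expectation (\<lambda>x. - f x) = - Z f X" for f X
    by (simp add: Z_def empirical_mean_def sum_negf)
  have int: "integrable ?P (\<lambda>X. exp (l * Z f X))" "integrable ?P (\<lambda>X. exp (l * (- Z f X)))"
    and le: "(\<integral>X. exp (l * Z f X) \<partial>?P) \<le> exp v" "(\<integral>X. exp (l * (- Z f X)) \<partial>?P) \<le> exp v" if "f \<in> F" for f
    using empirical_mean_mgf[OF m[OF that] bd[OF that] n l]
      empirical_mean_mgf[of "\<lambda>x. - f x" c n l, unfolded neg] m[OF that] bd[OF that] n l
    by (auto simp: Z_def v_def)
  have iS: "integrable ?P S" unfolding S_def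
    by (intro Bochner_Integration.integrable_sum Bochner_Integration.integrable_add int)
  have "(\<integral>X. S X \<partial>?P) = (\<Sum>f\<in>F. (\<integral>X. exp (l * Z f X) \<partial>?P) + (\<integral>X. exp (l * (- Z f X)) \<partial>?P))"
  proof -
    have "(\<integral>X. S X \<partial>?P) = (\<Sum>f\<in>F. \<integral>X. exp (l * Z f X) + exp (l * (- Z f X)) \<partial>?P)"
      unfolding S_def by (intro Bochner_Integration.integral_sum Bochner_Integration.integrable_add int)
    also have "\<dots> = (\<Sum>f\<in>F. (\<integral>X. exp (l * Z f X) \<partial>?P) + (\<integral>X. exp (l * (- Z f X)) \<partial>?P))"
      by (intro sum.cong refl Bochner_Integration.integral_add int)
    finally show ?thesis .
  qed
  also have "\<dots> \<le> (\<Sum>f\<in>F. exp v + exp v)" by (intro sum_mono add_mono le)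
  also have "\<dots> = A" by (simp add: A_def)
  finally have ES: "(\<integral>X. S X \<partial>?P) \<le> A" .
  have iW: "integrable ?P W" unfolding W_def
    by (intro integrable_mult_right Bochner_Integration.integrable_add Bochner_Integration.integrable_diff integrable_divide iS PP.integrable_const)
  have W0: "0 \<le> W X" for X
  proof -
    obtain f where "f \<in> F" using F by auto
    from W_ge[OF this, of X] show ?thesis by linarith
  qed
  have "(\<integral>X. W X \<partial>?P) = (1 / l) * (ln A - 1 + (\<integral>X. S X \<partial>?P) / A)"
    unfolding W_def using iS by (simp add: PP.prob_space del: One_nat_def)
  also have "\<dots> \<le> (1 / l) * (ln A - 1 + 1)"
    using ES A l by (intro mult_left_mono add_left_mono) (auto simp: divide_le_eq)
  also have "\<dots> \<le> (1 / l) * (q + v)"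
    using q l cF by (intro mult_left_mono) (auto simp: A_def ln_mult)
  also have "v = q" using n c q0 by (simp add: v_def l_def power_divide)
  also have "(1 / l) * (q + q) = c * sqrt (2 * q / real n)"
  proof -
    have "sqrt (2 * q / real n) * sqrt (2 * real n * q) = sqrt ((2 * q)\<^sup>2)"
      unfolding real_sqrt_mult[symmetric] using n by (simp add: power2_eq_square)
    then have "sqrt (2 * q / real n) * sqrt (2 * real n * q) = 2 * q" using q0 by (simp only: real_sqrt_abs)
    then show ?thesis using l c q0 n by (simp add: l_def field_simps)
  qed
  finally have "(\<integral>X. W X \<partial>?P) \<le> c * sqrt (2 * q / real n)" .
  moreover have "(\<integral>\<^sup>+X. ennreal (W X) \<partial>?P) = ennreal (\<integral>X. W X \<partial>?P)"
    using iW W0 by (intro nn_integral_eq_integral) auto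
  ultimately have "(\<integral>\<^sup>+X. ennreal (W X) \<partial>?P) \<le> ennreal (c * sqrt (2 * q / real n))"
    by (simp add: ennreal_leI)
  moreover have "W \<in> borel_measurable ?P" using iW by auto
  ultimately show thesis using that W0 W_ge unfolding Z_def by blast
qed

section \<open>Dyadic chaining\<close>

lemma sum_Suc_div_power2: "(\<Sum>l<N. (real l + 1) / 2 ^ l) = 4 - (2 * real N + 4) / 2 ^ N"
proof (induction N)
  case (Suc N)
  have "4 - (2 * real N + 4) / 2 ^ N + (real N + 1) / 2 ^ N = 4 - (2 * real (Suc N) + 4) / 2 ^ Suc N"
    by (simp add: divide_simps)
  then show ?case by (simp only: sum.lessThan_Suc Suc)
qed simp

lemma sum_Suc_div_power2_le: "(\<Sum>l<N. (real l + 1) / 2 ^ l) \<le> 4"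
  unfolding sum_Suc_div_power2 by simp

lemma empirical_mean_diff: "empirical_mean n (\<lambda>x. f x - g x) X = empirical_mean n f X - empirical_mean n g X"
  by (simp add: empirical_mean_def sum_subtractf right_diff_distrib)

lemma empirical_mean_abs_le:
  assumes "1 \<le> n" "\<And>i. i \<in> {1..n} \<Longrightarrow> \<bar>f (X i)\<bar> \<le> c"
  shows "\<bar>empirical_mean n f X\<bar> \<le> c"
proof -
  have "\<bar>\<Sum>i=1..n. f (X i)\<bar> \<le> (\<Sum>i=1..n. c)"
    using assms(2) by (intro order_trans[OF sum_abs] sum_mono)
  then show ?thesis using assms(1) by (simp add: empirical_mean_def abs_mult divide_le_eq mult.commute)
qed

text \<open>Each \<open>g\<close> is the telescoping sum of the differences between its approximants at consecutive
  levels. At level \<open>l\<close> there are \<open>exp (O (H l))\<close> differences, all of size \<open>O (L / 2 ^ l)\<close>, so the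
  maximal inequality contributes \<open>L * sqrt (H * l / n) / 2 ^ l\<close>, which is summable in \<open>l\<close>. This
  summability is what avoids the extra factor \<open>sqrt (ln n)\<close> that a cover at a single scale would cost.\<close>

lemma (in prob_space) dyadic_chaining:
  assumes n: "1 \<le> n" and L: "0 < L" and Hpos: "1 \<le> H"
    and G: "\<And>g. g \<in> G \<Longrightarrow> g \<in> borel_measurable M"
    and Gb: "\<And>g x. g \<in> G \<Longrightarrow> \<bar>g x\<bar> \<le> L"
    and T: "\<And>l. 1 \<le> l \<Longrightarrow> finite (T l)" "\<And>l h. 1 \<le> l \<Longrightarrow> h \<in> T l \<Longrightarrow> h \<in> borel_measurable M"
    and cT: "\<And>l. 1 \<le> l \<Longrightarrow> real (card (T l)) \<le> exp (H * real l)"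
    and ap: "\<And>l g. 1 \<le> l \<Longrightarrow> g \<in> G \<Longrightarrow> \<exists>h\<in>T l. \<forall>x. \<bar>g x - h x\<bar> \<le> L / 2 ^ l"
  obtains W where "W \<in> borel_measurable (\<Pi>\<^sub>M i\<in>{1..n}. M)" "\<And>X. 0 \<le> W X"
    "\<And>X g. g \<in> G \<Longrightarrow> \<bar>empirical_mean n g X - expectation g\<bar> \<le> W X"
    "(\<integral>\<^sup>+X. ennreal (W X) \<partial>(\<Pi>\<^sub>M i\<in>{1..n}. M)) \<le> ennreal (20 * L * sqrt (H / real n))"
proof -
  let ?P = "\<Pi>\<^sub>M i\<in>{1..n}. M"
  interpret PP: prob_space ?P by (rule prob_space_PiM) unfold_locales
  \<comment> \<open>Level 0 is the zero function: it approximates every \<open>g\<close> within \<open>L\<close> and its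
    empirical mean equals its expectation, so that the chain starts at deviation 0.\<close>
  define U where "U l = (if l = 0 then {\<lambda>_. 0} else T l)" for l
  have U: "finite (U l)" "\<And>h. h \<in> U l \<Longrightarrow> h \<in> borel_measurable M" "real (card (U l)) \<le> exp (H * real l)" for l
    using T[of l] cT[of l] by (cases "l = 0"; simp add: U_def)+
  have "\<exists>h\<in>U l. \<forall>x. \<bar>g x - h x\<bar> \<le> L / 2 ^ l" if "g \<in> G" for g l
    using ap[of l g] Gb[OF that] that by (cases "l = 0") (auto simp: U_def)
  note near = this
  define p where "p l g = (SOME h. h \<in> U l \<and> (\<forall>x. \<bar>g x - h x\<bar> \<le> L / 2 ^ l))" for l g
  have "p l g \<in> U l \<and> (\<forall>x. \<bar>g x - p l g x\<bar> \<le> L / 2 ^ l)" if "g \<in> G" for l g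
  proof -
    have "\<exists>h. h \<in> U l \<and> (\<forall>x. \<bar>g x - h x\<bar> \<le> L / 2 ^ l)" using near[OF that, of l] by blast
    from someI_ex[OF this] show ?thesis unfolding p_def .
  qed
  then have p: "\<And>l g. g \<in> G \<Longrightarrow> p l g \<in> U l" "\<And>l g x. g \<in> G \<Longrightarrow> \<bar>g x - p l g x\<bar> \<le> L / 2 ^ l"
    by auto
  define c where "c l = 3 * L / 2 ^ Suc l" for l
  \<comment> \<open>the links of the chains between the levels \<open>l\<close> and \<open>Suc l\<close>; the zero function
    makes the set nonempty\<close>
  define E where "E l = insert (\<lambda>_. 0)
     {(\<lambda>x. h x - h' x) | h h'. h \<in> U (Suc l) \<and> h' \<in> U l \<and> (\<forall>x. \<bar>h x - h' x\<bar> \<le> c l)}" for l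
  have c0: "0 < c l" for l using L by (simp add: c_def)
  have E_sub: "E l \<subseteq> insert (\<lambda>_. 0) ((\<lambda>(h, h') x. h x - h' x) ` (U (Suc l) \<times> U l))" for l
    unfolding E_def by auto
  have finE: "finite (E l)" for l using finite_subset[OF E_sub] U(1) by auto
  have cardE: "ln (2 * real (card (E l))) \<le> H * (4 * (real l + 1))" for l
  proof -
    have "card (E l) \<le> Suc (card ((\<lambda>(h, h') x. h x - h' x) ` (U (Suc l) \<times> U l)))"
      using card_mono[OF _ E_sub, of l] U(1) by (auto intro: order_trans[OF _ card_insert_le_m1] simp: card_insert_if split: if_splits)
    also have "\<dots> \<le> Suc (card (U (Suc l)) * card (U l))"
      using card_image_le[of "U (Suc l) \<times> U l" "\<lambda>(h, h') x. h x - h' x"] U(1)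
      by (simp add: card_cartesian_product)
    finally have "real (card (E l)) \<le> 1 + real (card (U (Suc l))) * real (card (U l))"
      by (metis of_nat_1 of_nat_add of_nat_le_iff of_nat_mult plus_1_eq_Suc)
    also have "\<dots> \<le> 1 + exp (H * real (Suc l)) * exp (H * real l)"
      by (intro add_left_mono mult_mono U) auto
    also have "\<dots> \<le> exp (H * (2 * real l + 1)) + exp (H * (2 * real l + 1))"
      using Hpos by (intro add_mono) (auto simp: exp_add[symmetric] algebra_simps)
    finally have "2 * real (card (E l)) \<le> 4 * exp (H * (2 * real l + 1))" by simp
    also have "\<dots> \<le> exp 2 * exp (H * (2 * real l + 1))"
    proof -
      have "(2::real) \<le> exp 1" using exp_ge_add_one_self[of 1] by simp
      then have "2 * 2 \<le> exp 1 * exp (1::real)" by (intro mult_mono) auto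
      then have "4 \<le> exp (1 + 1 :: real)" unfolding exp_add by simp
      then have "4 \<le> exp (2::real)" by simp
      then show ?thesis by (intro mult_right_mono) auto
    qed
    also have "\<dots> = exp (2 + H * (2 * real l + 1))" by (simp add: exp_add)
    also have "\<dots> \<le> exp (H * (4 * (real l + 1)))"
    proof -
      have "0 \<le> H * real l" using Hpos by simp
      moreover have "H * (4 * (real l + 1)) = H * (2 * real l + 1) + 2 * (H * real l) + 3 * H"
        by (simp add: algebra_simps)
      ultimately have "2 + H * (2 * real l + 1) \<le> H * (4 * (real l + 1))" using Hpos by linarith
      then show ?thesis by (simp only: exp_le_cancel_iff)
    qed
    finally have le: "2 * real (card (E l)) \<le> exp (H * (4 * (real l + 1)))" .
    have "0 < card (E l)" using finE[of l] by (auto simp: card_gt_0_iff E_def)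
    then have "ln (2 * real (card (E l))) \<le> ln (exp (H * (4 * (real l + 1))))"
      using le by (subst ln_le_cancel_iff) auto
    then show ?thesis by simp
  qed
  have "\<exists>W. W \<in> borel_measurable ?P \<and> (\<forall>X. 0 \<le> W X) \<and>
      (\<forall>X. \<forall>f\<in>E l. \<bar>empirical_mean n f X - expectation f\<bar> \<le> W X) \<and>
      (\<integral>\<^sup>+X. ennreal (W X) \<partial>?P) \<le> ennreal (c l * sqrt (2 * (H * (4 * (real l + 1))) / real n))" for l
  proof -
    have m: "f \<in> borel_measurable M" if "f \<in> E l" for f
      using that U(2) by (auto simp: E_def)
    have bd: "\<bar>f x\<bar> \<le> c l" if "f \<in> E l" "x \<in> space M" for f x
      using that(1) less_imp_le[OF c0] by (auto simp: E_def)
    have ne: "E l \<noteq> {}" by (simp add: E_def)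
    show ?thesis
    proof (rule subgaussian_maximal_inequality[of "E l" "H * (4 * (real l + 1))" "c l" n])
      fix W
      assume "W \<in> borel_measurable ?P" "\<And>X. 0 \<le> W X"
        "\<And>X f. f \<in> E l \<Longrightarrow> \<bar>empirical_mean n f X - expectation f\<bar> \<le> W X"
        "(\<integral>\<^sup>+X. ennreal (W X) \<partial>?P) \<le> ennreal (c l * sqrt (2 * (H * (4 * (real l + 1))) / real n))"
      then show ?thesis by blast
    qed (fact finE ne cardE c0 n m bd)+
  qed
  then obtain W where W: "\<And>l. W l \<in> borel_measurable ?P" "\<And>l X. 0 \<le> W l X"
      "\<And>l X f. f \<in> E l \<Longrightarrow> \<bar>empirical_mean n f X - expectation f\<bar> \<le> W l X"
      "\<And>l. (\<integral>\<^sup>+X. ennreal (W l X) \<partial>?P) \<le> ennreal (c l * sqrt (2 * (H * (4 * (real l + 1))) / real n))"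
    by metis
  \<comment> \<open>The chain stops at level \<open>n\<close>, where the remainder \<open>L / 2 ^ n\<close> is below \<open>L / sqrt n\<close>.\<close>
  define V where "V X = (\<Sum>l<n. W l X) + 2 * L / 2 ^ n" for X
  have Vm: "V \<in> borel_measurable ?P" unfolding V_def by (intro borel_measurable_add borel_measurable_sum W) auto
  have V0: "0 \<le> V X" for X unfolding V_def using L by (intro add_nonneg_nonneg sum_nonneg W) auto
  have dom: "\<bar>empirical_mean n g X - expectation g\<bar> \<le> V X" if g: "g \<in> G" for g X
  proof -
    define Z where "Z f = empirical_mean n f X - expectation f" for f
    have bU: "\<bar>p l g x\<bar> \<le> 2 * L" for l x
    proof -
      have "L / 2 ^ l \<le> L" using L by (simp add: divide_le_eq)
      then show ?thesis using p(2)[OF g, of x l] Gb[OF g, of x] by linarith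
    qed
    have ip: "integrable M (p l g)" for l
      by (rule integrable_bounded[OF U(2)[OF p(1)[OF g]]]) (rule bU)
    have ig: "integrable M g" by (rule integrable_bounded[OF G[OF g]]) (rule Gb[OF g])
    have Zdiff: "Z (\<lambda>x. f x - h x) = Z f - Z h" if "integrable M f" "integrable M h" for f h
      using that by (simp add: Z_def empirical_mean_diff)
    have step: "\<bar>Z (p (Suc l) g) - Z (p l g)\<bar> \<le> W l X" for l
    proof -
      have "\<bar>p (Suc l) g x - p l g x\<bar> \<le> c l" for x
      proof -
        have "L / 2 ^ l + L / 2 ^ Suc l = c l" by (simp add: c_def field_simps)
        then show ?thesis using p(2)[OF g, of x l] p(2)[OF g, of x "Suc l"] by linarith
      qed
      then have "(\<lambda>x. p (Suc l) g x - p l g x) \<in> E l"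
        unfolding E_def using p(1)[OF g] by blast
      from W(3)[OF this, of X] show ?thesis using Zdiff[OF ip ip] by (simp add: Z_def)
    qed
    have z0: "Z (p 0 g) = 0" using p(1)[OF g, of 0] by (simp add: U_def Z_def empirical_mean_def)
    have "Z (p n g) = (\<Sum>l<n. Z (p (Suc l) g) - Z (p l g))"
      using sum_lessThan_telescope[of "\<lambda>l. Z (p l g)" n] z0 by simp
    also have "\<bar>\<dots>\<bar> \<le> (\<Sum>l<n. W l X)" by (intro order_trans[OF sum_abs] sum_mono step)
    finally have a: "\<bar>Z (p n g)\<bar> \<le> (\<Sum>l<n. W l X)" .
    have "\<bar>Z (\<lambda>x. g x - p n g x)\<bar> \<le> L / 2 ^ n + L / 2 ^ n"
      unfolding Z_def
      by (intro order_trans[OF abs_triangle_ineq4] add_mono empirical_mean_abs_le[OF n] expectation_bounded p(2)[OF g]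
        borel_measurable_diff G[OF g] U(2)[OF p(1)[OF g]])
    then show ?thesis using a Zdiff[OF ig ip, of n] by (simp add: V_def Z_def)
  qed
  have cl: "c l * sqrt (2 * (H * (4 * (real l + 1))) / real n) \<le> 3 * L * sqrt (H / real n) * (sqrt 2 * ((real l + 1) / 2 ^ l))" for l
  proof -
    have "sqrt (real l + 1) \<le> real l + 1" using real_sqrt_le_mono[of "real l + 1" "(real l + 1)\<^sup>2"]
      by (simp add: power2_eq_square)
    moreover have "sqrt (2 * (H * (4 * (real l + 1))) / real n) = sqrt (H / real n) * sqrt 2 * 2 * sqrt (real l + 1)"
    proof -
      have "2 * (H * (4 * (real l + 1))) / real n = (H / real n) * 2 * 2\<^sup>2 * (real l + 1)" by (simp add: field_simps)
      then show ?thesis by (simp only: real_sqrt_mult real_sqrt_abs abs_numeral)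
    qed
    moreover have "0 \<le> c l * (sqrt (H / real n) * sqrt 2 * 2)" using c0[of l] Hpos n by simp
    ultimately have "c l * sqrt (2 * (H * (4 * (real l + 1))) / real n)
        = c l * (sqrt (H / real n) * sqrt 2 * 2) * sqrt (real l + 1)"
      and mono: "c l * (sqrt (H / real n) * sqrt 2 * 2) * sqrt (real l + 1)
        \<le> c l * (sqrt (H / real n) * sqrt 2 * 2) * (real l + 1)"
      by (simp only: mult.assoc, intro mult_left_mono)
    note this(1)
    also note mono
    also have "\<dots> = 3 * L * sqrt (H / real n) * (sqrt 2 * ((real l + 1) / 2 ^ l))"
      by (simp add: c_def field_simps)
    finally show ?thesis .
  qed
  have rem: "2 * L / 2 ^ n \<le> 2 * L * sqrt (H / real n)"
  proof -
    have "1 / 2 ^ n \<le> 1 / sqrt (real n)"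
    proof -
      have "sqrt (real n) \<le> real n" using n real_sqrt_le_mono[of "real n" "(real n)\<^sup>2"] by (simp add: power2_eq_square)
      also have "\<dots> \<le> 2 ^ n" by (simp add: of_nat_less_two_power less_imp_le)
      finally show ?thesis using n by (intro divide_left_mono) auto
    qed
    also have "\<dots> \<le> sqrt (H / real n)" using Hpos n by (simp add: real_sqrt_divide divide_right_mono)
    finally show ?thesis using L by (simp add: field_simps)
  qed
  have bound: "(\<Sum>l<n. c l * sqrt (2 * (H * (4 * (real l + 1))) / real n)) + 2 * L / 2 ^ n \<le> 20 * L * sqrt (H / real n)"
  proof -
    let ?K = "3 * L * sqrt (H / real n)"
    have K0: "0 \<le> ?K" using L Hpos by simp
    have "(\<Sum>l<n. c l * sqrt (2 * (H * (4 * (real l + 1))) / real n)) \<le> (\<Sum>l<n. ?K * (sqrt 2 * ((real l + 1) / 2 ^ l)))"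
      by (intro sum_mono cl)
    also have "\<dots> = ?K * sqrt 2 * (\<Sum>l<n. (real l + 1) / 2 ^ l)"
      by (simp only: sum_distrib_left mult.assoc)
    also have "\<dots> \<le> ?K * (3 / 2) * 4"
    proof (rule mult_mono[OF mult_left_mono[OF _ K0] sum_Suc_div_power2_le])
      show "sqrt 2 \<le> 3 / 2" by (rule real_le_lsqrt) (auto simp: power2_eq_square)
      show "0 \<le> ?K * (3 / 2)" by (rule mult_nonneg_nonneg[OF K0]) simp
    qed (auto intro: sum_nonneg)
    finally show ?thesis using rem by simp
  qed
  have "(\<integral>\<^sup>+X. ennreal (V X) \<partial>?P) = (\<Sum>l<n. \<integral>\<^sup>+X. ennreal (W l X) \<partial>?P) + ennreal (2 * L / 2 ^ n)"
  proof -
    have "ennreal (V X) = (\<Sum>l<n. ennreal (W l X)) + ennreal (2 * L / 2 ^ n)" for X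
      unfolding V_def using L W(2) by (subst ennreal_plus) (auto intro: sum_nonneg)
    then show ?thesis using W(1)
      by (simp add: nn_integral_add nn_integral_sum PP.emeasure_space_1 del: One_nat_def)
  qed
  also have "\<dots> \<le> (\<Sum>l<n. ennreal (c l * sqrt (2 * (H * (4 * (real l + 1))) / real n))) + ennreal (2 * L / 2 ^ n)"
    by (intro add_mono sum_mono W) auto
  also have "\<dots> = ennreal ((\<Sum>l<n. c l * sqrt (2 * (H * (4 * (real l + 1))) / real n)) + 2 * L / 2 ^ n)"
    using c0 L Hpos by (subst ennreal_plus) (auto intro!: sum_nonneg mult_nonneg_nonneg simp: less_imp_le)
  also have "\<dots> \<le> ennreal (20 * L * sqrt (H / real n))" using bound by (rule ennreal_leI)
  finally show thesis using that Vm V0 dom by blast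
qed

section \<open>Dyadic covers of the class of truncated networks\<close>

text \<open>The truncated networks in normalised coordinates: all parameters range over \<open>[-1, 1]\<close>, the scale
  \<open>a\<close> is factored out, and the bounds on \<open>l1_norm\<close> are relaxed to bounds on the components, which
  costs only factors of the dimension and turns the parameter set into a product.\<close>

definition box_net ::
  "nat \<Rightarrow> real \<Rightarrow> real \<Rightarrow> (nat \<Rightarrow> real) \<Rightarrow> (nat \<Rightarrow> real ^ 'n) \<Rightarrow> (nat \<Rightarrow> real) \<Rightarrow> real ^ 'n \<Rightarrow> real" where
  "box_net k a r \<beta> w b x =
     a * (2 / real k * (\<Sum>i=1..k. \<beta> i * relu (w i \<bullet> x + b i)) + w 0 \<bullet> x + b 0) * indicator (cball 0 r) x"

definition in_box :: "nat \<Rightarrow> (nat \<Rightarrow> real) \<Rightarrow> (nat \<Rightarrow> real ^ 'n) \<Rightarrow> (nat \<Rightarrow> real) \<Rightarrow> bool" where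
  "in_box k \<beta> w b \<longleftrightarrow> (\<forall>i\<in>{1..k}. \<bar>\<beta> i\<bar> \<le> 1) \<and> (\<forall>i\<in>{0..k}. \<bar>b i\<bar> \<le> 1 \<and> (\<forall>j. \<bar>w i $ j\<bar> \<le> 1))"

lemma component_le_l1_norm: "\<bar>w $ j\<bar> \<le> l1_norm w"
  unfolding l1_norm_def by (rule member_le_sum) auto

lemma truncated_relu_net_box:
  fixes g :: "real ^ 'n \<Rightarrow> real"
  assumes g: "g \<in> truncated_relu_nets k a r" and a: "0 < a" and k: "1 \<le> k"
  obtains \<beta> w b where "in_box k \<beta> w b" "g = box_net k a r \<beta> w b"
proof -
  obtain h where h: "h \<in> neural_nets k 1 (2 * inverse (real k) * a) a a relu"
    and gh: "g = (\<lambda>x. h x * indicator (cball 0 r) x)"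
    using g unfolding truncated_relu_nets_def by auto
  from h obtain \<beta> w b where
    h: "h = (\<lambda>x. (\<Sum>i=1..k. \<beta> i * relu (w i \<bullet> x + b i)) + w 0 \<bullet> x + b 0)"
    and wb: "\<And>i. i \<in> {1..k} \<Longrightarrow> l1_norm (w i) \<le> 1 \<and> \<bar>b i\<bar> \<le> 1 \<and> \<bar>\<beta> i\<bar> \<le> 2 * inverse (real k) * a"
    and wb0: "\<bar>b 0\<bar> \<le> a" "l1_norm (w 0) \<le> a"
    unfolding neural_nets_def by fastforce
  define \<beta>' where "\<beta>' i = \<beta> i * real k / (2 * a)" for i
  define w' where "w' i = (if i = 0 then (1 / a) *\<^sub>R w i else w i)" for i
  define b' where "b' i = (if i = 0 then b i / a else b i)" for i
  have 1: "\<bar>\<beta>' i\<bar> \<le> 1" if "i \<in> {1..k}" for i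
  proof -
    have "\<bar>\<beta> i\<bar> * real k \<le> 2 * inverse (real k) * a * real k"
      using wb[OF that] by (intro mult_right_mono) auto
    also have "\<dots> = 2 * a" using k by (simp add: field_simps)
    finally show ?thesis using a by (simp add: \<beta>'_def abs_mult divide_le_eq)
  qed
  have 2: "\<bar>w' i $ j\<bar> \<le> 1" "\<bar>b' i\<bar> \<le> 1" if "i \<in> {0..k}" for i j
  proof -
    have "\<bar>w' i $ j\<bar> \<le> 1 \<and> \<bar>b' i\<bar> \<le> 1"
    proof (cases "i = 0")
      case True
      then show ?thesis
        using wb0 component_le_l1_norm[of "w 0" j] a by (simp add: w'_def b'_def abs_mult divide_le_eq)
    next
      case False
      then show ?thesis
        using wb[of i] component_le_l1_norm[of "w i" j] that by (simp add: w'_def b'_def)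
    qed
    then show "\<bar>w' i $ j\<bar> \<le> 1" "\<bar>b' i\<bar> \<le> 1" by auto
  qed
  have "box_net k a r \<beta>' w' b' = g"
  proof
    fix x
    have "(\<Sum>i=1..k. \<beta>' i * relu (w' i \<bullet> x + b' i)) = (\<Sum>i=1..k. real k / (2 * a) * (\<beta> i * relu (w i \<bullet> x + b i)))"
      by (intro sum.cong refl) (auto simp: \<beta>'_def w'_def b'_def)
    also have "\<dots> = real k / (2 * a) * (\<Sum>i=1..k. \<beta> i * relu (w i \<bullet> x + b i))"
      by (rule sum_distrib_left[symmetric])
    finally show "box_net k a r \<beta>' w' b' x = g x"
      using a k unfolding box_net_def gh h by (simp add: w'_def b'_def field_simps)
  qed
  moreover have "in_box k \<beta>' w' b'" unfolding in_box_def using 1 2 by blast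
  ultimately show thesis using that by metis
qed

lemma abs_inner_le_componentwise:
  fixes v x :: "real ^ 'n"
  assumes "\<And>j. \<bar>v $ j\<bar> \<le> c" "norm x \<le> r"
  shows "\<bar>v \<bullet> x\<bar> \<le> real CARD('n) * r * c"
proof -
  have "\<bar>v \<bullet> x\<bar> \<le> l1_norm v * norm x" by (rule abs_inner_le_l1_norm)
  also have "\<dots> \<le> (real CARD('n) * c) * r"
  proof (rule mult_mono)
    have "l1_norm v \<le> (\<Sum>j\<in>(UNIV::'n set). c)" unfolding l1_norm_def by (intro sum_mono assms)
    then show "l1_norm v \<le> real CARD('n) * c" by simp
    have "0 \<le> c" using assms(1)[of undefined] by linarith
    then show "0 \<le> real CARD('n) * c" by simp
  qed (use assms in auto)
  finally show ?thesis by (simp add: mult_ac)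
qed

lemma relu_diff: "\<bar>relu u - relu v\<bar> \<le> \<bar>u - v\<bar>"
  by (auto simp: relu_def)

lemma relu_abs: "\<bar>relu u\<bar> \<le> \<bar>u\<bar>"
  by (auto simp: relu_def)

text \<open>Stability of a network under a perturbation of all parameters by at most \<open>\<delta>\<close>: a pre-activation moves by
  \<open>(d r + 1) * \<delta>\<close>, a neuron by twice that, and the output weight \<open>2 / k\<close> averages over the neurons,
  so that the constant does not grow with their number.\<close>

lemma box_net_diff:
  fixes w w' :: "nat \<Rightarrow> real ^ 'n"
  assumes box: "in_box k \<beta> w b" "in_box k \<beta>' w' b'" and k: "1 \<le> k" and a: "0 < a" and r: "0 \<le> r"
    and d\<beta>: "\<And>i. i \<in> {1..k} \<Longrightarrow> \<bar>\<beta> i - \<beta>' i\<bar> \<le> \<delta>"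
    and dw: "\<And>i j. i \<in> {0..k} \<Longrightarrow> \<bar>w i $ j - w' i $ j\<bar> \<le> \<delta>"
    and db: "\<And>i. i \<in> {0..k} \<Longrightarrow> \<bar>b i - b' i\<bar> \<le> \<delta>"
  shows "\<bar>box_net k a r \<beta> w b x - box_net k a r \<beta>' w' b' x\<bar> \<le> 5 * a * (real CARD('n) * r + 1) * \<delta>"
proof -
  let ?D = "real CARD('n) * r + 1"
  have \<delta>0: "0 \<le> \<delta>" using db[of 0] by auto
  have D: "1 \<le> ?D" using r by simp
  show ?thesis
  proof (cases "x \<in> cball 0 r")
    case False
    then show ?thesis using \<delta>0 a D by (simp add: box_net_def)
  next
    case True
    then have x: "norm x \<le> r" by simp
    let ?u = "\<lambda>i. w i \<bullet> x + b i" and ?v = "\<lambda>i. w' i \<bullet> x + b' i"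
    have uv: "\<bar>?u i - ?v i\<bar> \<le> ?D * \<delta>" if "i \<in> {0..k}" for i
    proof -
      have "\<bar>(w i - w' i) \<bullet> x\<bar> \<le> real CARD('n) * r * \<delta>"
        using dw[OF that] x by (intro abs_inner_le_componentwise) auto
      then show ?thesis using db[OF that] by (simp add: inner_diff_left algebra_simps)
    qed
    have v: "\<bar>?v i\<bar> \<le> ?D" if "i \<in> {0..k}" for i
    proof -
      have "\<bar>w' i \<bullet> x\<bar> \<le> real CARD('n) * r * 1"
        using box(2) that x by (intro abs_inner_le_componentwise) (auto simp: in_box_def)
      moreover have "\<bar>b' i\<bar> \<le> 1" using box(2) that by (auto simp: in_box_def)
      ultimately show ?thesis by simp
    qed
    have neuron: "\<bar>\<beta> i * relu (?u i) - \<beta>' i * relu (?v i)\<bar> \<le> 2 * ?D * \<delta>" if i: "i \<in> {1..k}" for i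
    proof -
      have "\<beta> i * relu (?u i) - \<beta>' i * relu (?v i) = \<beta> i * (relu (?u i) - relu (?v i)) + (\<beta> i - \<beta>' i) * relu (?v i)"
        by (simp add: algebra_simps)
      also have "\<bar>\<dots>\<bar> \<le> \<bar>\<beta> i\<bar> * \<bar>relu (?u i) - relu (?v i)\<bar> + \<bar>\<beta> i - \<beta>' i\<bar> * \<bar>relu (?v i)\<bar>"
        by (metis abs_mult abs_triangle_ineq)
      also have "\<dots> \<le> 1 * (?D * \<delta>) + \<delta> * ?D"
      proof (intro add_mono mult_mono)
        have i0: "i \<in> {0..k}" using i by simp
        show "\<bar>relu (?u i) - relu (?v i)\<bar> \<le> ?D * \<delta>" using relu_diff uv[OF i0] by (rule order_trans)
        show "\<bar>relu (?v i)\<bar> \<le> ?D" using relu_abs v[OF i0] by (rule order_trans)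
        show "\<bar>\<beta> i\<bar> \<le> 1" using box(1) i by (auto simp: in_box_def)
      qed (use d\<beta>[OF i] \<delta>0 in auto)
      finally show ?thesis by (simp add: mult_ac)
    qed
    have "\<bar>(\<Sum>i=1..k. \<beta> i * relu (?u i)) - (\<Sum>i=1..k. \<beta>' i * relu (?v i))\<bar>
        \<le> (\<Sum>i=1..k. 2 * ?D * \<delta>)"
      unfolding sum_subtractf[symmetric] by (intro order_trans[OF sum_abs] sum_mono neuron)
    then have S: "\<bar>(\<Sum>i=1..k. \<beta> i * relu (?u i)) - (\<Sum>i=1..k. \<beta>' i * relu (?v i))\<bar> \<le> real k * (2 * ?D * \<delta>)"
      by simp
    define s where "s = (\<Sum>i=1..k. \<beta> i * relu (?u i)) - (\<Sum>i=1..k. \<beta>' i * relu (?v i))"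
    have S2: "\<bar>2 / real k * s\<bar> \<le> 4 * ?D * \<delta>"
    proof -
      have "\<bar>2 / real k * s\<bar> = 2 / real k * \<bar>s\<bar>" by (simp add: abs_mult)
      also have "\<dots> \<le> 2 / real k * (real k * (2 * ?D * \<delta>))"
        using S unfolding s_def by (intro mult_left_mono) auto
      also have "\<dots> = 4 * ?D * \<delta>" using k by simp
      finally show ?thesis .
    qed
    have "box_net k a r \<beta> w b x - box_net k a r \<beta>' w' b' x = a * (2 / real k * s + (?u 0 - ?v 0))"
      using True by (simp add: box_net_def s_def algebra_simps)
    also have "\<bar>\<dots>\<bar> = a * \<bar>2 / real k * s + (?u 0 - ?v 0)\<bar>" using a by (simp add: abs_mult)
    also have "\<dots> \<le> a * (4 * ?D * \<delta> + ?D * \<delta>)"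
      using a S2 uv[of 0] by (intro mult_left_mono order_trans[OF abs_triangle_ineq] add_mono) auto
    finally show ?thesis by (simp add: algebra_simps)
  qed
qed

text \<open>The perturbation bound with \<open>\<delta> = 1\<close>, compared with the zero network.\<close>

lemma box_net_bounded:
  fixes w :: "nat \<Rightarrow> real ^ 'n"
  assumes "in_box k \<beta> w b" "1 \<le> k" "0 < a" "0 \<le> r"
  shows "\<bar>box_net k a r \<beta> w b x\<bar> \<le> 5 * a * (real CARD('n) * r + 1)"
  using box_net_diff[OF assms(1), of "\<lambda>_. 0" "\<lambda>_. 0" "\<lambda>_. 0" a r 1 x] assms
  by (simp add: in_box_def box_net_def)

lemma box_net_measurable: "box_net k a r \<beta> w b \<in> borel_measurable borel"
  unfolding box_net_def[abs_def] relu_def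
  by (intro borel_measurable_times borel_measurable_add borel_measurable_sum borel_measurable_const
    borel_measurable_indicator borel_measurable_max borel_measurable_inner measurable_ident_sets refl)
    (auto intro: borel_closed)

definition grid :: "nat \<Rightarrow> real set" where
  "grid l = (\<lambda>j::int. real_of_int j / 2 ^ l) ` {- (2 ^ l)..2 ^ l}"

lemma grid_finite: "finite (grid l)"
  by (simp add: grid_def)

lemma grid_abs: "z \<in> grid l \<Longrightarrow> \<bar>z\<bar> \<le> 1"
proof -
  assume "z \<in> grid l"
  then obtain j :: int where j: "- (2 ^ l) \<le> j" "j \<le> 2 ^ l" "z = real_of_int j / 2 ^ l"
    by (auto simp: grid_def)
  have "real_of_int \<bar>j\<bar> \<le> real_of_int (2 ^ l)"
    using j by (subst of_int_le_iff) auto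
  then have "\<bar>real_of_int j\<bar> \<le> 2 ^ l" by simp
  then show ?thesis by (simp add: j(3))
qed

lemma grid_card: "1 \<le> l \<Longrightarrow> card (grid l) \<le> 8 ^ l"
proof -
  assume l: "1 \<le> l"
  have "card (grid l) \<le> card {- (2 ^ l)..(2::int) ^ l}" unfolding grid_def by (rule card_image_le) simp
  also have "\<dots> = nat (2 * 2 ^ l + 1)" by simp
  also have "\<dots> = 2 * 2 ^ l + 1" by (simp add: nat_add_distrib nat_mult_distrib nat_power_eq)
  also have "\<dots> \<le> 4 * 2 ^ l" by simp
  also have "\<dots> \<le> 4 ^ l * 2 ^ l" using l self_le_power[of "4::nat" l] by (intro mult_right_mono) auto
  also have "\<dots> = 8 ^ l" by (simp add: power_mult_distrib[symmetric])
  finally show ?thesis .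
qed

definition round_down :: "nat \<Rightarrow> real \<Rightarrow> real" where
  "round_down l z = real_of_int \<lfloor>z * 2 ^ l\<rfloor> / 2 ^ l"

lemma round_down_grid:
  assumes "\<bar>z\<bar> \<le> 1"
  shows "round_down l z \<in> grid l"
proof -
  have "\<bar>z * 2 ^ l\<bar> \<le> 2 ^ l" using assms by (simp add: abs_mult)
  then have bnd: "- (2 ^ l) \<le> z * 2 ^ l" "z * 2 ^ l \<le> 2 ^ l" by linarith+
  then have "- (2 ^ l) \<le> \<lfloor>z * 2 ^ l\<rfloor>" "real_of_int \<lfloor>z * 2 ^ l\<rfloor> \<le> real_of_int (2 ^ l)"
    using order_trans[OF of_int_floor_le bnd(2)] by (simp_all only: le_floor_iff of_int_minus of_int_power of_int_numeral)
  then have "- (2 ^ l) \<le> \<lfloor>z * 2 ^ l\<rfloor>" "\<lfloor>z * 2 ^ l\<rfloor> \<le> 2 ^ l"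
    by (simp_all only: of_int_le_iff)
  then show ?thesis by (auto simp: grid_def round_down_def)
qed

lemma round_down_diff: "\<bar>z - round_down l z\<bar> \<le> 1 / 2 ^ l"
proof -
  have "z - round_down l z = (z * 2 ^ l - real_of_int \<lfloor>z * 2 ^ l\<rfloor>) / 2 ^ l"
    by (simp add: round_down_def field_simps)
  moreover have "\<bar>z * 2 ^ l - real_of_int \<lfloor>z * 2 ^ l\<rfloor>\<bar> \<le> 1" by linarith
  ultimately show ?thesis by (simp add: divide_right_mono)
qed

text \<open>Vectors are functions on the finite index type, counted as such.\<close>

lemma card_vec_le:
  assumes "finite A"
  shows "finite {v :: 'a ^ 'n. \<forall>j. v $ j \<in> A}" "card {v :: 'a ^ 'n. \<forall>j. v $ j \<in> A} \<le> card A ^ CARD('n)"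
proof -
  have eq: "{v :: 'a ^ 'n. \<forall>j. v $ j \<in> A} \<subseteq> vec_lambda ` (UNIV \<rightarrow>\<^sub>E A)"
  proof
    fix v :: "'a ^ 'n" assume "v \<in> {v. \<forall>j. v $ j \<in> A}"
    then have "v = vec_lambda (\<lambda>j. v $ j)" "(\<lambda>j. v $ j) \<in> UNIV \<rightarrow>\<^sub>E A" by auto
    then show "v \<in> vec_lambda ` (UNIV \<rightarrow>\<^sub>E A)" by blast
  qed
  have fin: "finite ((UNIV :: 'n set) \<rightarrow>\<^sub>E A)" using assms by (intro finite_PiE) auto
  show "finite {v :: 'a ^ 'n. \<forall>j. v $ j \<in> A}" using finite_subset[OF eq] fin by blast
  have "card {v :: 'a ^ 'n. \<forall>j. v $ j \<in> A} \<le> card (vec_lambda ` ((UNIV :: 'n set) \<rightarrow>\<^sub>E A))"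
    using eq fin by (intro card_mono) auto
  also have "\<dots> \<le> card ((UNIV :: 'n set) \<rightarrow>\<^sub>E A)" using fin by (rule card_image_le)
  also have "\<dots> = card A ^ CARD('n)" by (simp add: card_funcsetE)
  finally show "card {v :: 'a ^ 'n. \<forall>j. v $ j \<in> A} \<le> card A ^ CARD('n)" .
qed

definition net_cover :: "nat \<Rightarrow> real \<Rightarrow> real \<Rightarrow> nat \<Rightarrow> (real ^ 'n \<Rightarrow> real) set" where
  "net_cover k a r l = (\<lambda>(\<beta>, w, b). box_net k a r \<beta> w b) `
     (({1..k} \<rightarrow>\<^sub>E grid l) \<times> ({0..k} \<rightarrow>\<^sub>E {v. \<forall>j. v $ j \<in> grid l}) \<times> ({0..k} \<rightarrow>\<^sub>E grid l))"

lemma net_coverE: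
  assumes "h \<in> net_cover k a r l"
  obtains \<beta> w b where "in_box k \<beta> w b" "h = box_net k a r \<beta> w b"
proof -
  obtain \<beta> w b where *: "\<beta> \<in> {1..k} \<rightarrow>\<^sub>E grid l" "w \<in> {0..k} \<rightarrow>\<^sub>E {v. \<forall>j. v $ j \<in> grid l}"
      "b \<in> {0..k} \<rightarrow>\<^sub>E grid l" "h = box_net k a r \<beta> w b"
    using assms unfolding net_cover_def by auto
  have "in_box k \<beta> w b" unfolding in_box_def
    using PiE_mem[OF *(1)] PiE_mem[OF *(2)] PiE_mem[OF *(3)] grid_abs by blast
  then show thesis using that *(4) by blast
qed

lemma net_cover_finite: "finite (net_cover k a r l)"
  unfolding net_cover_def
  by (intro finite_imageI finite_cartesian_product finite_PiE grid_finite card_vec_le) auto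

text \<open>There are \<open>k + (d + 1) * (k + 1)\<close> parameters, at most \<open>(2 d + 3) * k\<close>, each with at most
  \<open>8 ^ l \<le> exp (3 l)\<close> grid values.\<close>

lemma net_cover_card:
  assumes k: "1 \<le> k" and l: "1 \<le> l"
  shows "real (card (net_cover k a r l :: (real ^ 'n \<Rightarrow> real) set))
    \<le> exp (3 * (2 * real CARD('n) + 3) * real k * real l)"
proof -
  let ?n = "CARD('n)" and ?V = "{v :: real ^ 'n. \<forall>j. v $ j \<in> grid l}" and ?g = "card (grid l)"
  let ?A = "({1..k} \<rightarrow>\<^sub>E grid l) \<times> ({0..k} \<rightarrow>\<^sub>E ?V) \<times> ({0..k} \<rightarrow>\<^sub>E grid l)"
  have "card (net_cover k a r l :: (real ^ 'n \<Rightarrow> real) set) \<le> card ?A"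
    unfolding net_cover_def
    by (intro card_image_le finite_cartesian_product finite_PiE grid_finite card_vec_le) auto
  also have "\<dots> = ?g ^ k * (card ?V ^ Suc k * ?g ^ Suc k)"
    by (simp only: card_cartesian_product card_funcsetE finite_atLeastAtMost card_atLeastAtMost) simp
  also have "\<dots> \<le> (8 ^ l) ^ k * (((8 ^ l) ^ ?n) ^ Suc k * (8 ^ l) ^ Suc k)"
    using grid_card[OF l] card_vec_le(2)[OF grid_finite, of l, where 'n = 'n]
    by (intro mult_mono power_mono order_trans[OF card_vec_le(2)[OF grid_finite]]) auto
  also have "\<dots> = 8 ^ (l * (k + ?n * Suc k + Suc k))"
    by (simp only: power_mult[symmetric] power_add[symmetric]) (simp add: algebra_simps)
  also have "\<dots> \<le> 8 ^ (l * ((2 * ?n + 3) * k))"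
  proof (rule power_increasing)
    have "k + ?n * Suc k + Suc k \<le> (2 * ?n + 3) * k"
    proof -
      have "(?n + 1) * 1 \<le> (?n + 1) * k" using k by (rule mult_le_mono2)
      then show ?thesis by (simp add: algebra_simps)
    qed
    then show "l * (k + ?n * Suc k + Suc k) \<le> l * ((2 * ?n + 3) * k)" by (rule mult_left_mono) simp
  qed simp
  finally have "real (card (net_cover k a r l :: (real ^ 'n \<Rightarrow> real) set)) \<le> real (8 ^ (l * ((2 * ?n + 3) * k)))"
    by (simp only: of_nat_le_iff)
  also have "\<dots> = 8 ^ (l * ((2 * ?n + 3) * k))" by simp
  also have "\<dots> \<le> exp 3 ^ (l * ((2 * ?n + 3) * k))"
  proof (rule power_mono)
    have "(2::real) \<le> exp 1" using exp_ge_add_one_self[of 1] by simp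
    then have "2 ^ 3 \<le> exp (1::real) ^ 3" by (rule power_mono) simp
    then show "8 \<le> exp (3::real)" by (simp add: exp_of_nat_mult[symmetric])
  qed simp
  also have "\<dots> = exp (3 * (2 * real ?n + 3) * real k * real l)"
    by (simp add: exp_of_nat_mult[symmetric] mult_ac)
  finally show ?thesis .
qed

lemma net_cover_near:
  fixes g :: "real ^ 'n \<Rightarrow> real"
  assumes g: "g \<in> truncated_relu_nets k a r" and a: "0 < a" and k: "1 \<le> k" and r: "0 \<le> r"
  shows "\<exists>h\<in>net_cover k a r l. \<forall>x. \<bar>g x - h x\<bar> \<le> 5 * a * (real CARD('n) * r + 1) / 2 ^ l"
proof -
  obtain \<beta> w b where box: "in_box k \<beta> w b" and g: "g = box_net k a r \<beta> w b"
    by (rule truncated_relu_net_box[OF g a k])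
  define \<beta>' where "\<beta>' = restrict (\<lambda>i. round_down l (\<beta> i)) {1..k}"
  define w' where "w' = restrict (\<lambda>i. (\<chi> j. round_down l (w i $ j)) :: real ^ 'n) {0..k}"
  define b' where "b' = restrict (\<lambda>i. round_down l (b i)) {0..k}"
  have mem: "\<beta>' \<in> {1..k} \<rightarrow>\<^sub>E grid l" "w' \<in> {0..k} \<rightarrow>\<^sub>E {v. \<forall>j. v $ j \<in> grid l}" "b' \<in> {0..k} \<rightarrow>\<^sub>E grid l"
    using box round_down_grid[of _ l] by (auto simp: \<beta>'_def w'_def b'_def in_box_def)
  then have cov: "box_net k a r \<beta>' w' b' \<in> net_cover k a r l"
    unfolding net_cover_def by (intro image_eqI[of _ _ "(\<beta>', w', b')"]) auto
  have box': "in_box k \<beta>' w' b'"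
    unfolding in_box_def using PiE_mem[OF mem(1)] PiE_mem[OF mem(2)] PiE_mem[OF mem(3)] grid_abs by blast
  have "\<bar>g x - box_net k a r \<beta>' w' b' x\<bar> \<le> 5 * a * (real CARD('n) * r + 1) * (1 / 2 ^ l)" for x
    unfolding g using round_down_diff[of _ l]
    by (intro box_net_diff box box' k a r) (auto simp: \<beta>'_def w'_def b'_def)
  then show ?thesis using cov by auto
qed

section \<open>Uniform deviation over networks\<close>

text \<open>The inequality \<open>exp w \<ge> 1 + w\<close> at \<open>w = v - u\<close> for \<open>v \<le> u\<close>.\<close>

lemma exp_lipschitz:
  fixes u v c :: real
  assumes "\<bar>u\<bar> \<le> c" "\<bar>v\<bar> \<le> c"
  shows "\<bar>exp u - exp v\<bar> \<le> exp c * \<bar>u - v\<bar>"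
proof -
  have *: "exp u - exp v \<le> exp c * (u - v)" if "v \<le> u" "u \<le> c" for u v :: real
  proof -
    have "exp u * (1 + (v - u)) \<le> exp u * exp (v - u)"
      using exp_ge_add_one_self[of "v - u"] by (intro mult_left_mono) auto
    also have "\<dots> = exp v" by (simp add: exp_diff)
    finally have "exp u - exp v \<le> exp u * (u - v)" by (simp add: algebra_simps)
    also have "\<dots> \<le> exp c * (u - v)" using that by (intro mult_right_mono) auto
    finally show ?thesis .
  qed
  show ?thesis
  proof (cases "v \<le> u")
    case True
    then show ?thesis using *[of v u] assms by simp
  next
    case False
    then show ?thesis using *[of u v] assms by simp
  qed
qed

text \<open>The Lipschitz constant of a network in its parameters, which also bounds its values. The dimension
  enters through a type argument since it is not determined by the real arguments.\<close>

definition net_bound :: "('n::finite) itself \<Rightarrow> real \<Rightarrow> real \<Rightarrow> real" where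
  "net_bound _ a r = 5 * a * (real CARD('n) * r + 1)"

text \<open>The rate at which the logarithmic cardinality of the dyadic covers grows with the level.\<close>

definition net_entropy :: "('n::finite) itself \<Rightarrow> nat \<Rightarrow> real" where
  "net_entropy _ k = 3 * (2 * real CARD('n) + 3) * real k"

lemma truncated_relu_net_measurable:
  fixes g :: "real ^ 'n \<Rightarrow> real"
  assumes "g \<in> truncated_relu_nets k a r" "0 < a" "1 \<le> k"
  shows "g \<in> borel_measurable borel"
  using truncated_relu_net_box[OF assms] box_net_measurable by metis

lemma truncated_relu_net_abs_le:
  fixes g :: "real ^ 'n \<Rightarrow> real"
  assumes "g \<in> truncated_relu_nets k a r" "0 < a" "1 \<le> k" "0 \<le> r"
  shows "\<bar>g x\<bar> \<le> net_bound TYPE('n) a r"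
  using truncated_relu_net_box[OF assms(1-3)] box_net_bounded[OF _ assms(3,2,4)]
  unfolding net_bound_def by metis

lemma net_cover_abs_le:
  fixes h :: "real ^ 'n \<Rightarrow> real"
  assumes "h \<in> net_cover k a r l" "0 < a" "1 \<le> k" "0 \<le> r"
  shows "\<bar>h x\<bar> \<le> net_bound TYPE('n) a r"
  using net_coverE[OF assms(1)] box_net_bounded[OF _ assms(3,2,4)]
  unfolding net_bound_def by metis

lemma net_bound_pos:
  assumes "0 < a" "0 \<le> r"
  shows "0 < net_bound TYPE('n::finite) a r"
  unfolding net_bound_def using assms by (intro mult_pos_pos add_nonneg_pos) auto

lemma net_entropy_ge_1:
  assumes "1 \<le> k"
  shows "1 \<le> net_entropy TYPE('n::finite) k"
proof -
  have "1 * 1 \<le> (3 * (2 * real CARD('n) + 3)) * real k" using assms by (intro mult_mono) auto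
  then show ?thesis by (simp add: net_entropy_def)
qed

text \<open>Stated for a Lipschitz function of the network output because the estimator needs it twice: for the identity on the
  sample from \<open>\<mu>\<close> and for \<open>\<lambda>u. exp u - 1\<close> on the sample from \<open>\<nu>\<close>. The condition \<open>\<psi> 0 = 0\<close> bounds the
  composed functions by the same constant as their increments.\<close>

lemma lipschitz_net_deviation:
  fixes \<mu> :: "(real ^ 'n) measure" and \<psi> :: "real \<Rightarrow> real"
  assumes prob: "prob_space \<mu>" and \<mu>: "sets \<mu> = sets borel"
    and n: "1 \<le> n" and k: "1 \<le> k" and a: "0 < a" and r: "0 \<le> r"
    and \<psi>: "\<psi> \<in> borel_measurable borel" "\<psi> 0 = 0" and S: "0 < S"
    and lip: "\<And>u v. \<bar>u\<bar> \<le> net_bound TYPE('n) a r \<Longrightarrow> \<bar>v\<bar> \<le> net_bound TYPE('n) a r \<Longrightarrow> \<bar>\<psi> u - \<psi> v\<bar> \<le> S * \<bar>u - v\<bar>"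
  obtains W where "W \<in> borel_measurable (\<Pi>\<^sub>M i\<in>{1..n}. \<mu>)" "\<And>X. 0 \<le> W X"
    "\<And>X g. g \<in> truncated_relu_nets k a r \<Longrightarrow> \<bar>empirical_mean n (\<lambda>x. \<psi> (g x)) X - (\<integral>x. \<psi> (g x) \<partial>\<mu>)\<bar> \<le> W X"
    "(\<integral>\<^sup>+X. ennreal (W X) \<partial>(\<Pi>\<^sub>M i\<in>{1..n}. \<mu>))
       \<le> ennreal (20 * (S * net_bound TYPE('n) a r) * sqrt (net_entropy TYPE('n) k / real n))"
proof -
  interpret prob_space \<mu> by fact
  let ?B = "net_bound TYPE('n) a r" and ?N = "truncated_relu_nets k a r :: (real ^ 'n \<Rightarrow> real) set"
  let ?C = "net_cover k a r :: nat \<Rightarrow> (real ^ 'n \<Rightarrow> real) set"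
  define comp where "comp g = (\<lambda>x. \<psi> (g x))" for g :: "real ^ 'n \<Rightarrow> real"
  have B0: "0 < ?B" using a r by (rule net_bound_pos)
  have meas: "comp g \<in> borel_measurable \<mu>" if "g \<in> borel_measurable borel" for g
    unfolding comp_def measurable_cong_sets[OF \<mu> refl] using that \<psi>(1) by (rule measurable_compose)
  show thesis
  proof (rule dyadic_chaining[of n "S * ?B" "net_entropy TYPE('n) k" "comp ` ?N" "\<lambda>l. comp ` ?C l"])
    show "1 \<le> n" by fact
    show "0 < S * ?B" using S B0 by simp
    show "1 \<le> net_entropy TYPE('n) k" using k by (rule net_entropy_ge_1)
    show "g \<in> borel_measurable \<mu>" if "g \<in> comp ` ?N" for g
      using that meas truncated_relu_net_measurable[OF _ a k] by auto
    show "\<bar>g x\<bar> \<le> S * ?B" if "g \<in> comp ` ?N" for g x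
    proof -
      obtain g' where g': "g' \<in> ?N" "g = comp g'" using \<open>g \<in> comp ` ?N\<close> by blast
      have "\<bar>g' x\<bar> \<le> ?B" using truncated_relu_net_abs_le[OF g'(1) a k r] .
      moreover from this have "\<bar>\<psi> (g' x) - \<psi> 0\<bar> \<le> S * \<bar>g' x - 0\<bar>" using B0 by (intro lip) auto
      moreover have "S * \<bar>g' x\<bar> \<le> S * ?B" using calculation(1) S by (intro mult_left_mono) auto
      ultimately have "\<bar>\<psi> (g' x)\<bar> \<le> S * ?B" by (simp only: \<psi>(2) diff_zero)
      then show ?thesis by (simp add: g'(2) comp_def)
    qed
    show "finite (comp ` ?C l)" if "1 \<le> l" for l by (intro finite_imageI net_cover_finite)
    show "h \<in> borel_measurable \<mu>" if "1 \<le> l" "h \<in> comp ` ?C l" for l h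
    proof -
      obtain h' where h': "h' \<in> ?C l" "h = comp h'" using \<open>h \<in> comp ` ?C l\<close> by blast
      have "h' \<in> borel_measurable borel" using h'(1) by (rule net_coverE) (simp add: box_net_measurable)
      then show ?thesis unfolding h'(2) by (rule meas)
    qed
    show "real (card (comp ` ?C l)) \<le> exp (net_entropy TYPE('n) k * real l)" if "1 \<le> l" for l
    proof -
      have "real (card (comp ` ?C l)) \<le> real (card (?C l))" using card_image_le[OF net_cover_finite] by simp
      also have "\<dots> \<le> exp (net_entropy TYPE('n) k * real l)"
        unfolding net_entropy_def by (rule net_cover_card[OF k that])
      finally show ?thesis .
    qed
    show "\<exists>h\<in>comp ` ?C l. \<forall>x. \<bar>g x - h x\<bar> \<le> S * ?B / 2 ^ l" if "1 \<le> l" "g \<in> comp ` ?N" for l g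
    proof -
      obtain g' where g': "g' \<in> ?N" "g = comp g'" using \<open>g \<in> comp ` ?N\<close> by blast
      obtain h where h: "h \<in> ?C l" "\<And>x. \<bar>g' x - h x\<bar> \<le> ?B / 2 ^ l"
        using net_cover_near[OF g'(1) a k r, of l] unfolding net_bound_def by blast
      have "\<bar>\<psi> (g' x) - \<psi> (h x)\<bar> \<le> S * (?B / 2 ^ l)" for x
      proof -
        have "\<bar>\<psi> (g' x) - \<psi> (h x)\<bar> \<le> S * \<bar>g' x - h x\<bar>"
          using truncated_relu_net_abs_le[OF g'(1) a k r] net_cover_abs_le[OF h(1) a k r] by (intro lip)
        also have "\<dots> \<le> S * (?B / 2 ^ l)" using h(2) S by (intro mult_left_mono) auto
        finally show ?thesis .
      qed
      then show ?thesis using h(1) by (intro bexI[of _ "comp h"]) (auto simp: g'(2) comp_def)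
    qed
    fix W
    assume W: "W \<in> borel_measurable (\<Pi>\<^sub>M i\<in>{1..n}. \<mu>)" "\<And>X. 0 \<le> W X"
      "\<And>X g. g \<in> comp ` ?N \<Longrightarrow> \<bar>empirical_mean n g X - expectation g\<bar> \<le> W X"
      "(\<integral>\<^sup>+X. ennreal (W X) \<partial>(\<Pi>\<^sub>M i\<in>{1..n}. \<mu>)) \<le> ennreal (20 * (S * ?B) * sqrt (net_entropy TYPE('n) k / real n))"
    show thesis
    proof (rule that[OF W(1,2) _ W(4)])
      fix X and g :: "real ^ 'n \<Rightarrow> real" assume "g \<in> ?N"
      then show "\<bar>empirical_mean n (\<lambda>x. \<psi> (g x)) X - (\<integral>x. \<psi> (g x) \<partial>\<mu>)\<bar> \<le> W X"
        using W(3)[of "comp g" X] by (simp add: comp_def)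
    qed
  qed
qed

section \<open>ReLU approximation of quadratic polynomials\<close>

text \<open>The Riemann sum of \<open>2 * relu (u - s)\<close> over \<open>s\<close>, whose integral is \<open>u\<^sup>2\<close>. With \<open>s\<^sub>i = relu (u - i h)\<close>
  the square telescopes into the terms \<open>s\<^sub>i\<^sup>2 - s\<^sub>i\<^sub>+\<^sub>1\<^sup>2\<close>, each within \<open>h\<^sup>2\<close> of \<open>2 h s\<^sub>i\<close>.\<close>

lemma relu_sum_square:
  fixes h u :: real
  assumes h: "0 \<le> h" and u: "0 \<le> u" "u \<le> real N * h"
  shows "\<bar>(\<Sum>i<N. 2 * h * relu (u - real i * h)) - u\<^sup>2\<bar> \<le> real N * h\<^sup>2"
proof -
  define s where "s i = relu (u - real i * h)" for i
  have step: "\<bar>2 * h * s i - ((s i)\<^sup>2 - (s (Suc i))\<^sup>2)\<bar> \<le> h\<^sup>2" for i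
  proof (cases "u - real i * h \<le> h")
    case True
    then have 1: "s (Suc i) = 0" "0 \<le> s i" "s i \<le> h" using h by (auto simp: s_def relu_def algebra_simps)
    then have "2 * h * s i - ((s i)\<^sup>2 - (s (Suc i))\<^sup>2) = h\<^sup>2 - (h - s i)\<^sup>2"
      by (simp add: power2_eq_square algebra_simps)
    moreover have "(h - s i)\<^sup>2 \<le> h\<^sup>2" using 1 by (intro power_mono) auto
    ultimately show ?thesis by simp
  next
    case False
    then have shift: "s (Suc i) = s i - h" using h by (auto simp: s_def relu_def algebra_simps)
    have "2 * h * s i - ((s i)\<^sup>2 - (s (Suc i))\<^sup>2) = h\<^sup>2"
      unfolding shift by (simp add: power2_eq_square algebra_simps)
    then show ?thesis by simp
  qed
  have "u\<^sup>2 = (s 0)\<^sup>2 - (s N)\<^sup>2" using u by (simp add: s_def relu_def)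
  also have "\<dots> = (\<Sum>i<N. (s i)\<^sup>2 - (s (Suc i))\<^sup>2)"
    by (rule sum_lessThan_telescope'[symmetric])
  finally have "(\<Sum>i<N. 2 * h * s i) - u\<^sup>2 = (\<Sum>i<N. 2 * h * s i - ((s i)\<^sup>2 - (s (Suc i))\<^sup>2))"
    by (simp add: sum_subtractf)
  also have "\<bar>\<dots>\<bar> \<le> (\<Sum>i<N. h\<^sup>2)" by (intro order_trans[OF sum_abs] sum_mono step)
  finally show ?thesis by (simp add: s_def)
qed

text \<open>Hidden neurons may be indexed by any set of at most \<open>k\<close> elements, the remaining ones being given output weight 0.\<close>

lemma neural_nets_finite_index:
  fixes w :: "'i \<Rightarrow> real ^ 'n"
  assumes I: "finite I" "card I \<le> k" and a: "0 \<le> a1" "0 \<le> a2"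
    and bd: "\<And>i. i \<in> I \<Longrightarrow> l1_norm (w i) \<le> a1 \<and> \<bar>b i\<bar> \<le> a1 \<and> \<bar>\<beta> i\<bar> \<le> a2"
    and bd0: "\<bar>b0\<bar> \<le> a3" "l1_norm w0 \<le> a4"
  shows "(\<lambda>x. (\<Sum>i\<in>I. \<beta> i * \<phi> (w i \<bullet> x + b i)) + w0 \<bullet> x + b0) \<in> neural_nets k a1 a2 a3 a4 \<phi>"
proof -
  obtain e where e: "bij_betw e {1..card I} I" using ex_bij_betw_nat_finite_1[OF I(1)] by blast
  define \<beta>' where "\<beta>' i = (if i \<in> {1..card I} then \<beta> (e i) else 0)" for i
  define w' where "w' i = (if i = 0 then w0 else if i \<in> {1..card I} then w (e i) else 0)" for i
  define b' where "b' i = (if i = 0 then b0 else if i \<in> {1..card I} then b (e i) else 0)" for i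
  have eI: "e i \<in> I" if "i \<in> {1..card I}" for i using bij_betw_apply[OF e that] .
  have "(\<Sum>i=1..k. \<beta>' i * \<phi> (w' i \<bullet> x + b' i)) = (\<Sum>i\<in>I. \<beta> i * \<phi> (w i \<bullet> x + b i))" for x
  proof -
    have "(\<Sum>i=1..k. \<beta>' i * \<phi> (w' i \<bullet> x + b' i)) = (\<Sum>i=1..card I. \<beta>' i * \<phi> (w' i \<bullet> x + b' i))"
      using I(2) by (intro sum.mono_neutral_right) (auto simp: \<beta>'_def)
    also have "\<dots> = (\<Sum>i=1..card I. \<beta> (e i) * \<phi> (w (e i) \<bullet> x + b (e i)))"
      by (intro sum.cong refl) (auto simp: \<beta>'_def w'_def b'_def)
    also have "\<dots> = (\<Sum>i\<in>I. \<beta> i * \<phi> (w i \<bullet> x + b i))"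
      by (rule sum.reindex_bij_betw[OF e])
    finally show ?thesis .
  qed
  moreover have "max (l1_norm (w' i)) \<bar>b' i\<bar> \<le> a1 \<and> \<bar>\<beta>' i\<bar> \<le> a2" if "i \<in> {1..k}" for i
    using that a bd[OF eI, of i] by (auto simp: \<beta>'_def w'_def b'_def l1_norm_def)
  ultimately show ?thesis
    unfolding neural_nets_def mem_Collect_eq using bd0
    by (intro exI[of _ \<beta>'] exI[of _ w'] exI[of _ b']) (auto simp: w'_def b'_def)
qed

text \<open>Each coordinate receives \<open>N = k div d\<close> neurons. Shifting by \<open>R\<close> makes the argument nonnegative,
  and \<open>x\<^sub>j\<^sup>2 = (x\<^sub>j + R)\<^sup>2 - 2 R x\<^sub>j - R\<^sup>2\<close> moves the shift into the affine part. Every neuron is scaled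
  by \<open>1 / R\<close> so that its inner weight and bias stay in \<open>[-1, 1]\<close>. For \<open>k < d\<close> there are no neurons,
  and the error bound is weak enough to hold without them.\<close>

lemma quadratic_relu_approx:
  fixes v :: "real ^ 'n"
  assumes K: "\<bar>\<alpha>\<bar> \<le> K" "norm v \<le> K" "\<bar>\<kappa>\<bar> \<le> K" and R: "1 \<le> R" and k: "1 \<le> k"
    and m: "4 * real CARD('n) * K * R\<^sup>2 \<le> m"
  shows "\<exists>g\<in>truncated_relu_nets k m R. \<forall>x\<in>cball 0 R.
    \<bar>g x - (\<alpha> * (norm x)\<^sup>2 + v \<bullet> x + \<kappa>)\<bar> \<le> 8 * (real CARD('n))\<^sup>2 * K * R\<^sup>2 / real k"
proof -
  define d where "d = CARD('n)"
  have d: "1 \<le> d" by (simp add: d_def Suc_leI)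
  define N where "N = k div d"
  \<comment> \<open>the mesh of the interval \<open>[0, 2 R]\<close>; it is 0 if there are no neurons\<close>
  define h where "h = 2 * R / real N"
  define I where "I = (UNIV :: 'n set) \<times> {..<N}"
  have K0: "0 \<le> K" using K(1) by linarith
  have R2: "R \<le> R\<^sup>2" "1 \<le> R\<^sup>2" using R by (auto simp: self_le_power one_le_power)
  have h0: "0 \<le> h" using R by (simp add: h_def)
  have N_inv: "1 / real N \<le> 2 * real d / real k" if "0 < N"
  proof -
    have "k < d * N + d" unfolding N_def
      using mod_less_divisor[of d k] mult_div_mod_eq[of d k] d by linarith
    also have "\<dots> \<le> 2 * d * N" using that d by (cases N) auto
    finally have "real k \<le> real (2 * d * N)" by (simp only: of_nat_le_iff)
    then show ?thesis using that k by (simp add: field_simps)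
  qed
  have hR: "h * R \<le> 4 * real d * R\<^sup>2 / real k"
  proof (cases "N = 0")
    case False
    have "h * R = 2 * R\<^sup>2 * (1 / real N)" by (simp add: h_def power2_eq_square)
    also have "\<dots> \<le> 2 * R\<^sup>2 * (2 * real d / real k)" using N_inv False by (intro mult_left_mono) auto
    finally show ?thesis by (simp add: mult_ac)
  qed (use R in \<open>simp add: h_def\<close>)
  define \<beta> where "\<beta> = (\<lambda>_ :: 'n \<times> nat. \<alpha> * (2 * h * R))"
  define w where "w = (\<lambda>(j :: 'n, _ :: nat). axis j (1 / R) :: real ^ 'n)"
  define b where "b = (\<lambda>(_ :: 'n, i :: nat). 1 - real i * h / R)"
  define w0 where "w0 = (\<chi> j. v $ j - 2 * R * \<alpha>)"
  define b0 where "b0 = \<kappa> - real d * \<alpha> * R\<^sup>2"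
  define G where "G = (\<lambda>x. (\<Sum>i\<in>I. \<beta> i * relu (w i \<bullet> x + b i)) + w0 \<bullet> x + b0)"
  have m0: "0 \<le> m" using m K0 by (auto intro: order_trans[rotated])
  have dK: "K * R\<^sup>2 \<le> real d * K * R\<^sup>2"
    using d K0 mult_right_mono[of 1 "real d" "K * R\<^sup>2"] by (simp add: mult_ac)
  have dK0: "0 \<le> real d * K * R\<^sup>2" using K0 by simp
  have m4: "4 * (real d * K * R\<^sup>2) \<le> m" using m by (simp add: d_def mult_ac)
  have "G \<in> neural_nets k 1 (2 * inverse (real k) * m) m m relu"
    unfolding G_def
  proof (rule neural_nets_finite_index)
    show "finite I" by (simp add: I_def)
    show "card I \<le> k" by (simp add: I_def card_cartesian_product d_def[symmetric] N_def)
    show "0 \<le> 2 * inverse (real k) * m" using m0 by simp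
    show "l1_norm (w i) \<le> 1 \<and> \<bar>b i\<bar> \<le> 1 \<and> \<bar>\<beta> i\<bar> \<le> 2 * inverse (real k) * m" if iI: "i \<in> I" for i
    proof -
      obtain j t where i: "i = (j, t)" "t < N" using iI by (cases i) (simp add: I_def)
      have "l1_norm (w i) = 1 / R"
        using R by (simp add: i w_def l1_norm_def axis_def if_distrib if_distribR sum.delta cong: if_cong)
      moreover have "real t * h / R \<le> 2" "0 \<le> real t * h / R"
        using i(2) R h0 by (auto simp: h_def field_simps)
      moreover have "\<bar>\<beta> i\<bar> \<le> 2 * inverse (real k) * m"
      proof -
        have "\<bar>\<beta> i\<bar> = \<bar>\<alpha>\<bar> * (2 * (h * R))" using h0 R by (simp add: \<beta>_def abs_mult)
        also have "\<dots> \<le> K * (2 * (4 * real d * R\<^sup>2 / real k))"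
          using hR K h0 R by (intro mult_mono mult_left_mono) auto
        also have "\<dots> = 2 * inverse (real k) * (4 * real d * K * R\<^sup>2)" by (simp add: field_simps)
        also have "\<dots> \<le> 2 * inverse (real k) * m" using m by (intro mult_left_mono) (auto simp: d_def)
        finally show ?thesis .
      qed
      ultimately show ?thesis using R by (simp add: i b_def)
    qed
    have "\<bar>b0\<bar> \<le> \<bar>\<kappa>\<bar> + real d * \<bar>\<alpha>\<bar> * R\<^sup>2"
      unfolding b0_def using abs_triangle_ineq4[of \<kappa> "real d * \<alpha> * R\<^sup>2"] by (simp add: abs_mult)
    also have "\<dots> \<le> K * R\<^sup>2 + real d * K * R\<^sup>2"
      using K R2 K0 mult_left_mono[OF R2(2) K0] by (intro add_mono mult_mono mult_left_mono) auto
    also have "\<dots> \<le> m" using m4 dK dK0 by linarith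
    finally show "\<bar>b0\<bar> \<le> m" .
    have "l1_norm w0 \<le> (\<Sum>j\<in>(UNIV :: 'n set). 3 * (K * R\<^sup>2))"
      unfolding l1_norm_def
    proof (intro sum_mono)
      fix j
      have "\<bar>v $ j\<bar> \<le> K" using component_le_norm_cart[of v j] K(2) by linarith
      moreover have "\<bar>2 * R * \<alpha>\<bar> \<le> 2 * R\<^sup>2 * K"
        using K R R2 by (simp add: abs_mult mult_mono)
      moreover have "K \<le> K * R\<^sup>2" using mult_left_mono[OF R2(2) K0] by simp
      ultimately show "\<bar>w0 $ j\<bar> \<le> 3 * (K * R\<^sup>2)" unfolding w0_def by (simp add: mult_ac)
    qed
    also have "\<dots> = 3 * (real d * K * R\<^sup>2)" by (simp add: d_def)
    also have "\<dots> \<le> m" using m4 dK0 by linarith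
    finally show "l1_norm w0 \<le> m" .
  qed simp
  then have net: "(\<lambda>x. G x * indicator (cball 0 R) x) \<in> truncated_relu_nets k m R"
    unfolding truncated_relu_nets_def by blast
  have "\<bar>G x - (\<alpha> * (norm x)\<^sup>2 + v \<bullet> x + \<kappa>)\<bar> \<le> 8 * (real d)\<^sup>2 * K * R\<^sup>2 / real k" if x: "norm x \<le> R" for x
  proof -
    define S where "S j = (\<Sum>i<N. 2 * h * relu (x $ j + R - real i * h))" for j
    have neuron: "\<beta> (j, i) * relu (w (j, i) \<bullet> x + b (j, i)) = \<alpha> * (2 * h * relu (x $ j + R - real i * h))" for j i
    proof -
      have "R * relu (x $ j / R + (1 - real i * h / R)) = relu (R * (x $ j / R + (1 - real i * h / R)))"
        using R by (simp add: relu_def max_mult_distrib_left)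
      also have "R * (x $ j / R + (1 - real i * h / R)) = x $ j + R - real i * h"
        using R by (simp add: field_simps)
      finally show ?thesis
        using R by (simp add: \<beta>_def w_def b_def inner_axis inner_commute[of _ x])
    qed
    have "(\<Sum>i\<in>I. \<beta> i * relu (w i \<bullet> x + b i)) = (\<Sum>j\<in>UNIV. \<Sum>i<N. \<beta> (j, i) * relu (w (j, i) \<bullet> x + b (j, i)))"
      unfolding I_def by (simp add: sum.cartesian_product case_prod_beta)
    also have "\<dots> = \<alpha> * (\<Sum>j\<in>UNIV. S j)"
      unfolding neuron S_def by (simp add: sum_distrib_left)
    finally have hidden: "(\<Sum>i\<in>I. \<beta> i * relu (w i \<bullet> x + b i)) = \<alpha> * (\<Sum>j\<in>UNIV. S j)" .
    have lin: "w0 \<bullet> x = v \<bullet> x - 2 * R * \<alpha> * (\<Sum>j\<in>UNIV. x $ j)"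
      by (simp add: w0_def inner_vec_def sum_subtractf sum_distrib_left left_diff_distrib)
    have sq: "(\<Sum>j\<in>UNIV. (x $ j + R)\<^sup>2) = (norm x)\<^sup>2 + 2 * R * (\<Sum>j\<in>UNIV. x $ j) + real d * R\<^sup>2"
    proof -
      have "(x $ j + R)\<^sup>2 = x $ j * x $ j + 2 * R * x $ j + R\<^sup>2" for j
        by (simp add: power2_eq_square algebra_simps)
      then show ?thesis
        unfolding power2_norm_eq_inner inner_vec_def d_def by (simp add: sum.distrib sum_distrib_left)
    qed
    have "G x - (\<alpha> * (norm x)\<^sup>2 + v \<bullet> x + \<kappa>) = \<alpha> * (\<Sum>j\<in>UNIV. S j - (x $ j + R)\<^sup>2)"
      unfolding G_def hidden lin b0_def sum_subtractf sq by (simp add: algebra_simps)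
    also have "\<bar>\<dots>\<bar> = \<bar>\<alpha>\<bar> * \<bar>\<Sum>j\<in>UNIV. S j - (x $ j + R)\<^sup>2\<bar>" by (rule abs_mult)
    also have "\<dots> \<le> K * (\<Sum>j\<in>(UNIV :: 'n set). 8 * real d * R\<^sup>2 / real k)"
    proof (intro mult_mono order_trans[OF sum_abs] sum_mono)
      fix j
      have xj: "0 \<le> x $ j + R" "x $ j + R \<le> 2 * R" using component_le_norm_cart[of x j] x by linarith+
      show "\<bar>S j - (x $ j + R)\<^sup>2\<bar> \<le> 8 * real d * R\<^sup>2 / real k"
      proof (cases "N = 0")
        case True
        then have "k < d" using d by (auto simp: N_def div_eq_0_iff)
        then have "1 \<le> 2 * real d / real k" using k by (simp add: field_simps)
        then have "4 * R\<^sup>2 * 1 \<le> 4 * R\<^sup>2 * (2 * real d / real k)" by (intro mult_left_mono) auto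
        moreover have "(x $ j + R)\<^sup>2 \<le> (2 * R)\<^sup>2" using xj by (intro power_mono) auto
        ultimately show ?thesis using True by (simp add: S_def power2_eq_square mult_ac)
      next
        case False
        have "\<bar>S j - (x $ j + R)\<^sup>2\<bar> \<le> real N * h\<^sup>2"
          unfolding S_def using xj False by (intro relu_sum_square h0) (auto simp: h_def)
        also have "\<dots> = 4 * R\<^sup>2 * (1 / real N)" using False by (simp add: h_def power2_eq_square)
        also have "\<dots> \<le> 4 * R\<^sup>2 * (2 * real d / real k)" using N_inv False by (intro mult_left_mono) auto
        finally show ?thesis by (simp add: mult_ac)
      qed
    qed (use K K0 in auto)
    also have "\<dots> = 8 * (real d)\<^sup>2 * K * R\<^sup>2 / real k" by (simp add: d_def power2_eq_square)
    finally show ?thesis .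
  qed
  then show ?thesis using net by (intro bexI[OF _ net]) (auto simp: d_def)
qed

section \<open>The variational representation of the divergence\<close>

text \<open>Two everywhere positive probability densities with respect to a common reference measure.\<close>

locale density_pair = sigma_finite_measure N for N :: "'a measure" +
  fixes p q :: "'a \<Rightarrow> real"
  assumes p_meas: "p \<in> borel_measurable N" and q_meas: "q \<in> borel_measurable N"
    and p_pos: "\<And>x. 0 < p x" and q_pos: "\<And>x. 0 < q x"
    and prob_p: "prob_space (density N p)" and prob_q: "prob_space (density N q)"
begin

abbreviation P :: "'a measure" where "P \<equiv> density N p"
abbreviation Q :: "'a measure" where "Q \<equiv> density N q"

definition log_ratio :: "'a \<Rightarrow> real" where
  "log_ratio x = ln (p x / q x)"

text \<open>The population version of the quantity maximised by the estimator.\<close>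

definition objective :: "('a \<Rightarrow> real) \<Rightarrow> real" where
  "objective g = (\<integral>x. g x \<partial>P) - (\<integral>x. exp (g x) - 1 \<partial>Q)"

lemma log_ratio_measurable: "log_ratio \<in> borel_measurable N"
  unfolding log_ratio_def[abs_def] using p_meas q_meas by measurable

lemma ratio_eq: "q x * exp (g x) = p x * exp (g x - log_ratio x)"
  using p_pos[of x] q_pos[of x] by (simp add: log_ratio_def exp_diff exp_ln)

lemma KL_eq_expectation: "KL P Q = (\<integral>x. log_ratio x \<partial>P)"
proof -
  have "KL P Q = (\<integral>x. p x * log (exp 1) (p x / q x) \<partial>N)"
    unfolding KL_def using p_meas q_meas p_pos q_pos
    by (intro KL_density_density) (auto simp: less_imp_le less_imp_neq[symmetric])
  also have "\<dots> = (\<integral>x. log_ratio x \<partial>P)"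
    using p_meas p_pos log_ratio_measurable
    by (subst integral_real_density) (auto simp: less_imp_le log_ratio_def log_def)
  finally show ?thesis .
qed

lemma integrable_P_iff: "h \<in> borel_measurable N \<Longrightarrow> integrable P h \<longleftrightarrow> integrable N (\<lambda>x. p x * h x)"
  using p_meas p_pos by (intro integrable_real_density) (auto simp: less_imp_le)

lemma integral_P: "h \<in> borel_measurable N \<Longrightarrow> (\<integral>x. h x \<partial>P) = (\<integral>x. p x * h x \<partial>N)"
  using p_meas p_pos by (intro integral_real_density) (auto simp: less_imp_le)

lemma integrable_Q_iff: "h \<in> borel_measurable N \<Longrightarrow> integrable Q h \<longleftrightarrow> integrable N (\<lambda>x. q x * h x)"
  using q_meas q_pos by (intro integrable_real_density) (auto simp: less_imp_le)

lemma integral_Q: "h \<in> borel_measurable N \<Longrightarrow> (\<integral>x. h x \<partial>Q) = (\<integral>x. q x * h x \<partial>N)"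
  using q_meas q_pos by (intro integral_real_density) (auto simp: less_imp_le)

lemma density_difference: "integrable N (\<lambda>x. p x - q x)" "(\<integral>x. p x - q x \<partial>N) = 0"
proof -
  interpret P: prob_space P by (rule prob_p)
  interpret Q: prob_space Q by (rule prob_q)
  have "integrable N p" "integrable N q"
    using integrable_P_iff[of "\<lambda>_. 1"] integrable_Q_iff[of "\<lambda>_. 1"] by auto
  moreover have "(\<integral>x. p x \<partial>N) = 1" "(\<integral>x. q x \<partial>N) = 1"
    using integral_P[of "\<lambda>_. 1"] integral_Q[of "\<lambda>_. 1"] P.prob_space Q.prob_space by auto
  ultimately show "integrable N (\<lambda>x. p x - q x)" "(\<integral>x. p x - q x \<partial>N) = 0" by auto
qed

context
  fixes g :: "'a \<Rightarrow> real" and c :: real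
  assumes f: "integrable P log_ratio"
    and g: "g \<in> borel_measurable N" and bd: "\<And>x. \<bar>g x\<bar> \<le> c"
begin

lemma integrable_objective: "integrable P g" "integrable Q (\<lambda>x. exp (g x) - 1)"
proof -
  interpret P: prob_space P by (rule prob_p)
  interpret Q: prob_space Q by (rule prob_q)
  show "integrable P g" using g bd by (intro P.integrable_const_bound[of _ c]) auto
  have "\<bar>exp (g x) - 1\<bar> \<le> exp c + 1" for x
  proof -
    have "exp (g x) \<le> exp c" "0 < exp (g x)" "0 < exp c" using bd[of x] by auto
    then show ?thesis by linarith
  qed
  then show "integrable Q (\<lambda>x. exp (g x) - 1)" using g by (intro Q.integrable_const_bound[of _ "exp c + 1"]) auto
qed

lemma KL_minus_objective_eq:
  shows "integrable N (\<lambda>x. p x * (log_ratio x - g x) + q x * (exp (g x) - 1))"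
    and "KL P Q - objective g = (\<integral>x. p x * (log_ratio x - g x) + q x * (exp (g x) - 1) \<partial>N)"
proof -
  have e: "(\<lambda>x. exp (g x) - 1) \<in> borel_measurable N" using g by measurable
  have i: "integrable N (\<lambda>x. p x * log_ratio x)" "integrable N (\<lambda>x. p x * g x)" "integrable N (\<lambda>x. q x * (exp (g x) - 1))"
    using integrable_objective f integrable_P_iff[OF g] integrable_P_iff[OF log_ratio_measurable] integrable_Q_iff[OF e] by auto
  have i1: "integrable N (\<lambda>x. p x * (log_ratio x - g x))"
    using Bochner_Integration.integrable_diff[OF i(1,2)] by (simp add: right_diff_distrib)
  have eq: "(\<integral>x. p x * (log_ratio x - g x) \<partial>N) = (\<integral>x. p x * log_ratio x \<partial>N) - (\<integral>x. p x * g x \<partial>N)"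
    using Bochner_Integration.integral_diff[OF i(1,2)] by (simp add: right_diff_distrib)
  show "integrable N (\<lambda>x. p x * (log_ratio x - g x) + q x * (exp (g x) - 1))"
    using i1 i(3) by (rule Bochner_Integration.integrable_add)
  show "KL P Q - objective g = (\<integral>x. p x * (log_ratio x - g x) + q x * (exp (g x) - 1) \<partial>N)"
    unfolding Bochner_Integration.integral_add[OF i1 i(3)] eq KL_eq_expectation objective_def
      integral_P[OF g] integral_P[OF log_ratio_measurable] integral_Q[OF e] by simp
qed

text \<open>Changing measure with \<open>q * exp log_ratio = p\<close> exhibits the gap between the divergence and the objective
  as the \<open>p\<close>-expectation of \<open>exp u - u - 1\<close> for \<open>u = g - log_ratio\<close>, up to \<open>p - q\<close>, which
  integrates to 0. Both bounds below are bounds for \<open>exp u - u - 1\<close>.\<close>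

lemma integrand_eq:
  "p x * (log_ratio x - g x) + q x * (exp (g x) - 1)
     = p x * (exp (g x - log_ratio x) - (g x - log_ratio x) - 1) + (p x - q x)"
  using ratio_eq[of x g] by (simp add: algebra_simps)

lemma objective_le_KL: "objective g \<le> KL P Q"
proof -
  have "0 = (\<integral>x. p x - q x \<partial>N)" using density_difference by simp
  also have "\<dots> \<le> (\<integral>x. p x * (log_ratio x - g x) + q x * (exp (g x) - 1) \<partial>N)"
  proof (rule integral_mono[OF density_difference(1) KL_minus_objective_eq(1)])
    fix x
    have "0 \<le> p x * (exp (g x - log_ratio x) - (g x - log_ratio x) - 1)"
    proof (rule mult_nonneg_nonneg)
      show "0 \<le> exp (g x - log_ratio x) - (g x - log_ratio x) - 1"
        using exp_ge_add_one_self[of "g x - log_ratio x"] by linarith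
    qed (use p_pos[of x] in simp)
    then show "p x - q x \<le> p x * (log_ratio x - g x) + q x * (exp (g x) - 1)"
      unfolding integrand_eq by simp
  qed
  finally show ?thesis using KL_minus_objective_eq(2) by simp
qed

text \<open>On \<open>B\<close> the gap is controlled by \<open>exp u - u - 1 \<le> \<epsilon> * exp \<epsilon>\<close>; off \<open>B\<close> the integrand is
  \<open>p * log_ratio\<close>, and \<open>q\<close> compensates for the term \<open>p - q\<close> that has been split off globally.\<close>

lemma KL_minus_objective_le:
  assumes B: "B \<in> sets N" and near: "\<And>x. x \<in> B \<Longrightarrow> \<bar>g x - log_ratio x\<bar> \<le> \<epsilon>"
    and off: "\<And>x. x \<notin> B \<Longrightarrow> g x = 0" and \<epsilon>: "0 \<le> \<epsilon>"
  shows "KL P Q - objective g \<le> \<epsilon> * exp \<epsilon>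
     + (\<integral>x. \<bar>log_ratio x\<bar> * indicator (- B) x \<partial>P) + (\<integral>x. indicator (- B) x \<partial>Q)"
proof -
  interpret P: prob_space P by (rule prob_p)
  interpret Q: prob_space Q by (rule prob_q)
  have ind: "(indicator (- B) :: 'a \<Rightarrow> real) \<in> borel_measurable N"
  proof -
    have "(\<lambda>x. 1 - indicator B x :: real) \<in> borel_measurable N" using B by measurable
    moreover have "(\<lambda>x. 1 - indicator B x :: real) = indicator (- B)" by (auto simp: indicator_def)
    ultimately show ?thesis by simp
  qed
  have m: "(\<lambda>x. \<bar>log_ratio x\<bar> * indicator (- B) x) \<in> borel_measurable N"
    using ind log_ratio_measurable by measurable
  have i1: "integrable P (\<lambda>x. \<epsilon> * exp \<epsilon>)" by simp
  have i2: "integrable P (\<lambda>x. \<bar>log_ratio x\<bar> * indicator (- B) x)"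
    by (rule Bochner_Integration.integrable_bound[OF f]) (use m in \<open>auto simp: indicator_def\<close>)
  have i3: "integrable Q (indicator (- B) :: 'a \<Rightarrow> real)"
    by (rule Q.integrable_const_bound[of _ 1], rule AE_I2, simp add: indicator_def, use ind in simp)
  have j1: "integrable N (\<lambda>x. p x * (\<epsilon> * exp \<epsilon>))" by (rule iffD1[OF integrable_P_iff i1]) simp
  have j2: "integrable N (\<lambda>x. p x * (\<bar>log_ratio x\<bar> * indicator (- B) x))" by (rule iffD1[OF integrable_P_iff[OF m] i2])
  have j3: "integrable N (\<lambda>x. q x * indicator (- B) x)" by (rule iffD1[OF integrable_Q_iff[OF ind] i3])
  note j = Bochner_Integration.integrable_add[OF j1 j2] Bochner_Integration.integrable_add[OF Bochner_Integration.integrable_add[OF j1 j2] j3]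
  have scalar: "exp u - u - 1 \<le> \<epsilon> * exp \<epsilon>" if "\<bar>u\<bar> \<le> \<epsilon>" for u :: real
  proof (cases "0 \<le> u")
    case True
    have "exp u * (1 - u) \<le> exp u * exp (- u)" using exp_ge_add_one_self[of "- u"] by (intro mult_left_mono) auto
    then have "exp u - 1 \<le> u * exp u" by (simp add: exp_minus algebra_simps)
    also have "\<dots> \<le> \<epsilon> * exp \<epsilon>" using that True by (intro mult_mono) auto
    finally show ?thesis using True by simp
  next
    case False
    then have "exp u < 1" by simp
    then have "exp u - u - 1 \<le> \<epsilon> * 1" using that by linarith
    also have "\<dots> \<le> \<epsilon> * exp \<epsilon>" using \<epsilon> by (intro mult_left_mono) auto
    finally show ?thesis .
  qed
  have "KL P Q - objective g \<le>
    (\<integral>x. p x * (\<epsilon> * exp \<epsilon>) + p x * (\<bar>log_ratio x\<bar> * indicator (- B) x) + q x * indicator (- B) x + (p x - q x) \<partial>N)"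
    unfolding KL_minus_objective_eq(2)
  proof (rule integral_mono[OF KL_minus_objective_eq(1)])
    show "integrable N (\<lambda>x. p x * (\<epsilon> * exp \<epsilon>) + p x * (\<bar>log_ratio x\<bar> * indicator (- B) x) + q x * indicator (- B) x + (p x - q x))"
      by (rule Bochner_Integration.integrable_add[OF j(2) density_difference(1)])
    fix x
    show "p x * (log_ratio x - g x) + q x * (exp (g x) - 1)
      \<le> p x * (\<epsilon> * exp \<epsilon>) + p x * (\<bar>log_ratio x\<bar> * indicator (- B) x) + q x * indicator (- B) x + (p x - q x)"
    proof (cases "x \<in> B")
      case True
      have "p x * (exp (g x - log_ratio x) - (g x - log_ratio x) - 1) \<le> p x * (\<epsilon> * exp \<epsilon>)"
        using p_pos[of x] by (intro mult_left_mono scalar near[OF True]) auto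
      then show ?thesis unfolding integrand_eq using True by simp
    next
      case False
      have "p x * log_ratio x \<le> p x * \<bar>log_ratio x\<bar>" using p_pos[of x] by (intro mult_left_mono) auto
      moreover have "0 \<le> p x * (\<epsilon> * exp \<epsilon>)" using p_pos[of x] \<epsilon> by simp
      moreover have "p x * (log_ratio x - g x) + q x * (exp (g x) - 1) = p x * log_ratio x"
        by (simp add: off[OF False])
      moreover have "p x * (\<bar>log_ratio x\<bar> * indicator (- B) x) + q x * indicator (- B) x = p x * \<bar>log_ratio x\<bar> + q x"
        using False by simp
      ultimately show ?thesis using p_pos[of x] by linarith
    qed
  qed
  also have "\<dots> = (\<integral>x. p x * (\<epsilon> * exp \<epsilon>) \<partial>N) + (\<integral>x. p x * (\<bar>log_ratio x\<bar> * indicator (- B) x) \<partial>N)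
      + (\<integral>x. q x * indicator (- B) x \<partial>N) + 0"
    unfolding Bochner_Integration.integral_add[OF j(2) density_difference(1)] Bochner_Integration.integral_add[OF j(1) j3]
      Bochner_Integration.integral_add[OF j1 j2] density_difference(2) ..
  also have "\<dots> = \<epsilon> * exp \<epsilon> + (\<integral>x. \<bar>log_ratio x\<bar> * indicator (- B) x \<partial>P) + (\<integral>x. indicator (- B) x \<partial>Q)"
    using integral_P[of "\<lambda>x. \<epsilon> * exp \<epsilon>"] integral_P[OF m] integral_Q[OF ind] P.prob_space by simp
  finally show ?thesis .
qed

end

end

section \<open>Risk of the estimator: bias plus deviation\<close>

lemma nn_integral_pair_marginals:
  assumes "prob_space A" "prob_space B"
    and u: "u \<in> borel_measurable A" and v: "v \<in> borel_measurable B"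
  shows "(\<integral>\<^sup>+z. u (fst z) + v (snd z) \<partial>(A \<Otimes>\<^sub>M B)) = (\<integral>\<^sup>+x. u x \<partial>A) + (\<integral>\<^sup>+y. v y \<partial>B)"
proof -
  interpret A: prob_space A by fact
  interpret B: prob_space B by fact
  have m: "(\<lambda>z. u (fst z)) \<in> borel_measurable (A \<Otimes>\<^sub>M B)" "(\<lambda>z. v (snd z)) \<in> borel_measurable (A \<Otimes>\<^sub>M B)"
    using u v by measurable
  have "(\<integral>\<^sup>+z. u (fst z) \<partial>(A \<Otimes>\<^sub>M B)) = (\<integral>\<^sup>+x. \<integral>\<^sup>+y. u x \<partial>B \<partial>A)"
    using B.nn_integral_fst[OF m(1)] by simp
  moreover have "(\<integral>\<^sup>+z. v (snd z) \<partial>(A \<Otimes>\<^sub>M B)) = (\<integral>\<^sup>+x. \<integral>\<^sup>+y. v y \<partial>B \<partial>A)"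
    using B.nn_integral_fst[OF m(2)] by simp
  ultimately show ?thesis
    unfolding nn_integral_add[OF m] by (simp add: B.emeasure_space_1 A.emeasure_space_1)
qed

text \<open>Every network has objective at most the divergence, so the supremum exceeds the divergence by at most the
  deviations; conversely the network \<open>g\<^sub>0\<close> keeps it above the divergence minus bias and deviations.\<close>

lemma KL_estimator_risk:
  fixes N :: "(real ^ 'n) measure" and p q :: "real ^ 'n \<Rightarrow> real"
  assumes dp: "density_pair N p q" and N: "sets N = sets borel"
    and n: "1 \<le> n" and k: "1 \<le> k" and a: "0 < a" and r: "0 \<le> r"
    and f: "integrable (density N p) (density_pair.log_ratio p q)"
    and g0: "g0 \<in> truncated_relu_nets k a r"
    and bias: "KL (density N p) (density N q) - density_pair.objective N p q g0 \<le> \<delta>"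
  shows "(\<integral>\<^sup>+ (X, Y). ennreal \<bar>KL_estimator (truncated_relu_nets k a r) n X Y - KL (density N p) (density N q)\<bar>
            \<partial>sample_law n (density N p) (density N q))
     \<le> ennreal (\<delta> + 40 * (exp (net_bound TYPE('n) a r) * net_bound TYPE('n) a r) * sqrt (net_entropy TYPE('n) k / real n))"
proof -
  interpret density_pair N p q by fact
  interpret P: prob_space P by (rule prob_p)
  interpret Q: prob_space Q by (rule prob_q)
  let ?B = "net_bound TYPE('n) a r" and ?G = "truncated_relu_nets k a r :: (real ^ 'n \<Rightarrow> real) set"
  let ?PP = "\<Pi>\<^sub>M i\<in>{1..n}. P" and ?QQ = "\<Pi>\<^sub>M i\<in>{1..n}. Q"
  interpret PP: prob_space ?PP by (rule prob_space_PiM) (rule prob_p)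
  interpret QQ: prob_space ?QQ by (rule prob_space_PiM) (rule prob_q)
  have B0: "0 < ?B" using a r by (rule net_bound_pos)
  let ?s = "sqrt (net_entropy TYPE('n) k / real n)"
  have s0: "0 \<le> ?s" using net_entropy_ge_1[OF k, where 'n = 'n] by simp
  obtain W1 where W1: "W1 \<in> borel_measurable ?PP" "\<And>X. 0 \<le> W1 X"
    "\<And>X g. g \<in> ?G \<Longrightarrow> \<bar>empirical_mean n (\<lambda>x. g x) X - (\<integral>x. g x \<partial>P)\<bar> \<le> W1 X"
    "(\<integral>\<^sup>+X. ennreal (W1 X) \<partial>?PP) \<le> ennreal (20 * (1 * ?B) * ?s)"
    by (rule lipschitz_net_deviation[OF prob_p _ n k a r, of "\<lambda>u. u" 1]) (auto simp: N)
  obtain W2 where W2: "W2 \<in> borel_measurable ?QQ" "\<And>X. 0 \<le> W2 X"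
    "\<And>X g. g \<in> ?G \<Longrightarrow> \<bar>empirical_mean n (\<lambda>x. exp (g x) - 1) X - (\<integral>x. exp (g x) - 1 \<partial>Q)\<bar> \<le> W2 X"
    "(\<integral>\<^sup>+X. ennreal (W2 X) \<partial>?QQ) \<le> ennreal (20 * (exp ?B * ?B) * ?s)"
    by (rule lipschitz_net_deviation[OF prob_q _ n k a r, of "\<lambda>u. exp u - 1" "exp ?B"])
      (auto simp: N intro: exp_lipschitz)
  define J where "J X Y g = empirical_mean n g X - empirical_mean n (\<lambda>x. exp (g x) - 1) Y" for X Y and g :: "real ^ 'n \<Rightarrow> real"
  have est: "KL_estimator ?G n X Y = (SUP g\<in>?G. J X Y g)" for X Y
    unfolding KL_estimator_def J_def empirical_mean_def sum_subtractf right_diff_distrib[symmetric] ..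
  have bdd: "bdd_above (J X Y ` ?G)" for X Y
    using KL_estimator_bdd_above[of n X Y k a r]
    unfolding J_def empirical_mean_def sum_subtractf right_diff_distrib[symmetric] .
  have Jdev: "\<bar>J X Y g - objective g\<bar> \<le> W1 X + W2 Y" if "g \<in> ?G" for X Y g
    using W1(3)[OF that, of X] W2(3)[OF that, of Y] unfolding J_def objective_def by linarith
  have upper: "objective g \<le> KL P Q" if "g \<in> ?G" for g
  proof (rule objective_le_KL[OF f])
    show "g \<in> borel_measurable N" unfolding measurable_cong_sets[OF N refl]
      using truncated_relu_net_measurable[OF that a k] .
    show "\<bar>g x\<bar> \<le> ?B" for x using truncated_relu_net_abs_le[OF that a k r] .
  qed
  have \<delta>0: "0 \<le> \<delta>" using upper[OF g0] bias by linarith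
  have dom: "\<bar>KL_estimator ?G n X Y - KL P Q\<bar> \<le> W1 X + W2 Y + \<delta>" for X Y
  proof -
    have "(SUP g\<in>?G. J X Y g) \<le> KL P Q + W1 X + W2 Y"
    proof (rule cSUP_least)
      show "?G \<noteq> {}" using g0 by blast
      show "J X Y g \<le> KL P Q + W1 X + W2 Y" if "g \<in> ?G" for g
        using Jdev[OF that, of X Y] upper[OF that] by linarith
    qed
    moreover have "J X Y g0 \<le> (SUP g\<in>?G. J X Y g)" by (rule cSUP_upper[OF g0 bdd])
    ultimately show ?thesis unfolding est using Jdev[OF g0, of X Y] bias \<delta>0 by linarith
  qed
  have "(\<integral>\<^sup>+ (X, Y). ennreal \<bar>KL_estimator ?G n X Y - KL P Q\<bar> \<partial>sample_law n P Q)
    \<le> (\<integral>\<^sup>+ z. (ennreal (W1 (fst z)) + ennreal \<delta>) + ennreal (W2 (snd z)) \<partial>(?PP \<Otimes>\<^sub>M ?QQ))"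
    unfolding sample_law_def case_prod_beta
  proof (rule nn_integral_mono)
    fix z
    have "ennreal \<bar>KL_estimator ?G n (fst z) (snd z) - KL P Q\<bar> \<le> ennreal (W1 (fst z) + \<delta> + W2 (snd z))"
      using dom[of "fst z" "snd z"] by (intro ennreal_leI) linarith
    also have "\<dots> = (ennreal (W1 (fst z)) + ennreal \<delta>) + ennreal (W2 (snd z))"
      using W1(2) W2(2) \<delta>0 by (simp add: ennreal_plus)
    finally show "ennreal \<bar>KL_estimator ?G n (fst z) (snd z) - KL P Q\<bar> \<le> (ennreal (W1 (fst z)) + ennreal \<delta>) + ennreal (W2 (snd z))" .
  qed
  also have "\<dots> = ((\<integral>\<^sup>+X. ennreal (W1 X) \<partial>?PP) + ennreal \<delta>) + (\<integral>\<^sup>+Y. ennreal (W2 Y) \<partial>?QQ)"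
  proof -
    have m: "(\<lambda>X. ennreal (W1 X) + ennreal \<delta>) \<in> borel_measurable ?PP" "(\<lambda>Y. ennreal (W2 Y)) \<in> borel_measurable ?QQ"
      using W1(1) W2(1) by (auto simp del: One_nat_def)
    have "(\<integral>\<^sup>+X. ennreal (W1 X) + ennreal \<delta> \<partial>?PP) = (\<integral>\<^sup>+X. ennreal (W1 X) \<partial>?PP) + ennreal \<delta>"
      using W1(1) by (simp add: nn_integral_add PP.emeasure_space_1 del: One_nat_def)
    then show ?thesis
      unfolding nn_integral_pair_marginals[OF PP.prob_space_axioms QQ.prob_space_axioms m] by simp
  qed
  also have "\<dots> \<le> (ennreal (20 * (exp ?B * ?B) * ?s) + ennreal \<delta>) + ennreal (20 * (exp ?B * ?B) * ?s)"
  proof (intro add_mono order_refl W2(4) order_trans[OF W1(4)] ennreal_leI mult_right_mono mult_left_mono)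
    show "1 \<le> exp ?B" using B0 by simp
  qed (use B0 s0 in auto)
  also have "\<dots> = ennreal (\<delta> + 40 * (exp ?B * ?B) * ?s)"
    using \<delta>0 B0 s0 by (subst ennreal_plus[symmetric], simp, simp)+ (simp add: algebra_simps)
  finally show ?thesis .
qed

section \<open>Gaussian densities\<close>

definition gauss_density :: "real ^ 'n \<Rightarrow> real \<Rightarrow> real ^ 'n \<Rightarrow> real" where
  "gauss_density m \<sigma> x = exp (- (norm (x - m))\<^sup>2 / (2 * \<sigma>\<^sup>2)) / (2 * pi * \<sigma>\<^sup>2) powr (real CARD('n) / 2)"

lemma isotropic_gaussian_eq_density: "isotropic_gaussian m \<sigma> = density lborel (gauss_density m \<sigma>)"
  unfolding isotropic_gaussian_def gauss_density_def ..

lemma gauss_density_pos: "0 < \<sigma> \<Longrightarrow> 0 < gauss_density m \<sigma> x"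
  unfolding gauss_density_def by simp

lemma gauss_density_measurable: "gauss_density m \<sigma> \<in> borel_measurable borel"
  unfolding gauss_density_def[abs_def] by measurable

text \<open>The exponential tilt of the density with standard deviation \<open>\<sigma>\<close> is \<open>2 ^ d\<close> times the density with standard
  deviation \<open>2 * \<sigma>\<close>, and the latter integrates to 1.\<close>

lemma gauss_square_exp_moment:
  fixes m :: "real ^ 'n"
  assumes s: "0 < \<sigma>"
  defines "E \<equiv> \<lambda>x. exp (3 * (norm (x - m))\<^sup>2 / (8 * \<sigma>\<^sup>2))"
  shows "integrable (isotropic_gaussian m \<sigma>) E" "(\<integral>x. E x \<partial>isotropic_gaussian m \<sigma>) = 2 ^ CARD('n)"
proof -
  let ?n = "CARD('n)"
  have pw: "(2 * pi * (2 * \<sigma>)\<^sup>2) powr (real ?n / 2) = 2 ^ ?n * (2 * pi * \<sigma>\<^sup>2) powr (real ?n / 2)"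
  proof -
    have "(2 * pi * (2 * \<sigma>)\<^sup>2) powr (real ?n / 2) = (4 * (2 * pi * \<sigma>\<^sup>2)) powr (real ?n / 2)"
      by (simp add: power_mult_distrib mult_ac)
    also have "\<dots> = 4 powr (real ?n / 2) * (2 * pi * \<sigma>\<^sup>2) powr (real ?n / 2)"
      by (rule powr_mult)
    also have "4 powr (real ?n / 2) = (2 powr 2) powr (real ?n / 2)" by simp
    also have "\<dots> = 2 powr real ?n" unfolding powr_powr by simp
    also have "\<dots> = 2 ^ ?n" by (simp add: powr_realpow)
    finally show ?thesis .
  qed
  have tilt: "gauss_density m \<sigma> x * E x = 2 ^ ?n * gauss_density m (2 * \<sigma>) x" for x
  proof -
    have "- (norm (x - m))\<^sup>2 / (2 * \<sigma>\<^sup>2) + 3 * (norm (x - m))\<^sup>2 / (8 * \<sigma>\<^sup>2) = - (norm (x - m))\<^sup>2 / (2 * (2 * \<sigma>)\<^sup>2)"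
      using s by (simp add: field_simps power2_eq_square)
    then have "exp (- (norm (x - m))\<^sup>2 / (2 * \<sigma>\<^sup>2)) * E x = exp (- (norm (x - m))\<^sup>2 / (2 * (2 * \<sigma>)\<^sup>2))"
      unfolding E_def exp_add[symmetric] by simp
    then show ?thesis unfolding gauss_density_def pw by (simp add: field_simps)
  qed
  interpret G2: prob_space "density lborel (gauss_density m (2 * \<sigma>))"
    using prob_space_isotropic_gaussian[of "2 * \<sigma>" m] s by (simp add: isotropic_gaussian_eq_density)
  have nn: "AE x in lborel. 0 \<le> gauss_density m \<tau> x" if "0 < \<tau>" for \<tau>
    by (intro AE_I2 less_imp_le gauss_density_pos that)
  have gm: "gauss_density m \<tau> \<in> borel_measurable lborel" for \<tau>
    using gauss_density_measurable[of m \<tau>] by simp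
  have s2: "0 < 2 * \<sigma>" using s by simp
  have "integrable (density lborel (gauss_density m (2 * \<sigma>))) (\<lambda>_. 1 :: real)" by simp
  from iffD1[OF integrable_real_density[OF gm nn[OF s2]] this]
  have i: "integrable lborel (gauss_density m (2 * \<sigma>))" by (simp only: mult_1_right borel_measurable_const simp_thms)
  have one: "(\<integral>x. gauss_density m (2 * \<sigma>) x \<partial>lborel) = 1"
    using integral_real_density[OF gm nn[OF s2] borel_measurable_const, of 1] G2.prob_space
    by (simp only: mult_1_right) simp
  have Em: "E \<in> borel_measurable lborel" unfolding E_def by measurable
  show "integrable (isotropic_gaussian m \<sigma>) E"
    unfolding isotropic_gaussian_eq_density integrable_real_density[OF gm nn[OF s] Em] tilt
    by (rule integrable_mult_right[OF i])
  show "(\<integral>x. E x \<partial>isotropic_gaussian m \<sigma>) = 2 ^ ?n"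
    unfolding isotropic_gaussian_eq_density integral_real_density[OF gm nn[OF s] Em] tilt
    by (simp only: integral_mult_right_zero one mult_1_right)
qed

lemma gauss_log_ratio:
  fixes mp mq :: "real ^ 'n"
  assumes "0 < \<sigma>p" "0 < \<sigma>q"
  shows "ln (gauss_density mp \<sigma>p x / gauss_density mq \<sigma>q x) =
     (inverse (\<sigma>q\<^sup>2) - inverse (\<sigma>p\<^sup>2)) / 2 * (norm x)\<^sup>2
     + (inverse (\<sigma>p\<^sup>2) *\<^sub>R mp - inverse (\<sigma>q\<^sup>2) *\<^sub>R mq) \<bullet> x
     + (inverse (\<sigma>q\<^sup>2) * (norm mq)\<^sup>2 / 2 - inverse (\<sigma>p\<^sup>2) * (norm mp)\<^sup>2 / 2 + real CARD('n) / 2 * (ln (\<sigma>q\<^sup>2) - ln (\<sigma>p\<^sup>2)))"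
proof -
  have ln_dens: "ln (gauss_density m \<sigma> x) = - inverse (\<sigma>\<^sup>2) * (norm (x - m))\<^sup>2 / 2 - real CARD('n) / 2 * (ln (2 * pi) + ln (\<sigma>\<^sup>2))"
    if "0 < \<sigma>" for m :: "real ^ 'n" and \<sigma>
  proof -
    have l: "ln (2 * pi * \<sigma>\<^sup>2) = ln (2 * pi) + ln (\<sigma>\<^sup>2)" using that by (intro ln_mult_pos) auto
    have d: "ln (gauss_density m \<sigma> x)
      = ln (exp (- (norm (x - m))\<^sup>2 / (2 * \<sigma>\<^sup>2))) - ln ((2 * pi * \<sigma>\<^sup>2) powr (real CARD('n) / 2))"
      unfolding gauss_density_def using that by (intro ln_divide_pos) auto
    have e: "- (norm (x - m))\<^sup>2 / (2 * \<sigma>\<^sup>2) = - inverse (\<sigma>\<^sup>2) * (norm (x - m))\<^sup>2 / 2"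
      using that by (simp add: field_simps)
    show ?thesis unfolding d ln_exp ln_powr l e ..
  qed
  have sq: "(norm (x - m))\<^sup>2 = (norm x)\<^sup>2 - 2 * (m \<bullet> x) + (norm m)\<^sup>2" for m :: "real ^ 'n"
    by (simp add: power2_norm_eq_inner inner_diff_left inner_diff_right inner_commute)
  have "ln (gauss_density mp \<sigma>p x / gauss_density mq \<sigma>q x) = ln (gauss_density mp \<sigma>p x) - ln (gauss_density mq \<sigma>q x)"
    using gauss_density_pos[OF assms(1), of mp x] gauss_density_pos[OF assms(2), of mq x] by (simp add: ln_div)
  then show ?thesis
    unfolding ln_dens[OF assms(1)] ln_dens[OF assms(2)] sq
    by (simp add: inner_diff_left diff_divide_distrib add_divide_distrib left_diff_distrib right_diff_distrib
      ring_distribs)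
qed

text \<open>Outside the ball \<open>norm (x - m) \<ge> t\<close>, so the square-exponential moment of exponent
  \<open>3/8 = 1/8 + 1/4\<close> (in units of \<open>1 / \<sigma>\<^sup>2\<close>) is split: one eighth dominates \<open>h\<close> and
  one quarter produces the factor \<open>exp (- t\<^sup>2 / (4 M))\<close>.\<close>

lemma gauss_tail_integral:
  fixes m :: "real ^ 'n"
  assumes \<sigma>: "0 < \<sigma>" "\<sigma>\<^sup>2 < M" and m: "norm m \<le> M" and t: "0 \<le> t" and A: "0 \<le> A"
    and h: "\<And>x. \<bar>h x\<bar> \<le> A * exp ((norm (x - m))\<^sup>2 / (8 * \<sigma>\<^sup>2))"
  shows "(\<integral>x. \<bar>h x\<bar> * indicator (- cball 0 (M + t)) x \<partial>isotropic_gaussian m \<sigma>)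
    \<le> A * exp (- t\<^sup>2 / (4 * M)) * 2 ^ CARD('n)"
proof -
  define E where "E x = exp (3 * (norm (x - m))\<^sup>2 / (8 * \<sigma>\<^sup>2))" for x
  have E: "integrable (isotropic_gaussian m \<sigma>) E" "(\<integral>x. E x \<partial>isotropic_gaussian m \<sigma>) = 2 ^ CARD('n)"
    unfolding E_def[abs_def] by (rule gauss_square_exp_moment[OF \<sigma>(1)])+
  have s2: "0 < \<sigma>\<^sup>2" using \<sigma> by simp
  have M0: "0 < M" using s2 \<sigma>(2) by linarith
  have "(\<integral>x. \<bar>h x\<bar> * indicator (- cball 0 (M + t)) x \<partial>isotropic_gaussian m \<sigma>)
    \<le> (\<integral>x. A * exp (- t\<^sup>2 / (4 * M)) * E x \<partial>isotropic_gaussian m \<sigma>)"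
  proof (rule integral_mono')
    show "integrable (isotropic_gaussian m \<sigma>) (\<lambda>x. A * exp (- t\<^sup>2 / (4 * M)) * E x)"
      using E(1) by (rule integrable_mult_right)
    fix x
    show "0 \<le> A * exp (- t\<^sup>2 / (4 * M)) * E x" using A by (simp add: E_def)
    show "\<bar>h x\<bar> * indicator (- cball 0 (M + t)) x \<le> A * exp (- t\<^sup>2 / (4 * M)) * E x"
    proof (cases "x \<in> cball 0 (M + t)")
      case True
      then show ?thesis using A by (simp add: E_def)
    next
      case False
      then have "t \<le> norm (x - m)" using m norm_triangle_ineq2[of x m] by simp
      then have "t\<^sup>2 \<le> (norm (x - m))\<^sup>2" using t by (intro power_mono)
      then have "t\<^sup>2 / (4 * M) \<le> (norm (x - m))\<^sup>2 / (4 * \<sigma>\<^sup>2)"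
        using s2 \<sigma>(2) by (intro frac_le) auto
      moreover have "3 * (norm (x - m))\<^sup>2 / (8 * \<sigma>\<^sup>2) = (norm (x - m))\<^sup>2 / (8 * \<sigma>\<^sup>2) + (norm (x - m))\<^sup>2 / (4 * \<sigma>\<^sup>2)"
        using s2 by (simp add: divide_simps)
      ultimately have "(norm (x - m))\<^sup>2 / (8 * \<sigma>\<^sup>2) \<le> - t\<^sup>2 / (4 * M) + 3 * (norm (x - m))\<^sup>2 / (8 * \<sigma>\<^sup>2)"
        by simp
      then have "exp ((norm (x - m))\<^sup>2 / (8 * \<sigma>\<^sup>2)) \<le> exp (- t\<^sup>2 / (4 * M)) * E x"
        unfolding E_def exp_add[symmetric] by (simp only: exp_le_cancel_iff)
      then have "A * exp ((norm (x - m))\<^sup>2 / (8 * \<sigma>\<^sup>2)) \<le> A * (exp (- t\<^sup>2 / (4 * M)) * E x)"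
        using A by (rule mult_left_mono)
      then show ?thesis using h[of x] False by (simp add: mult.assoc)
    qed
  qed
  also have "\<dots> = A * exp (- t\<^sup>2 / (4 * M)) * 2 ^ CARD('n)"
    unfolding integral_mult_right_zero E(2) ..
  finally show ?thesis .
qed

section \<open>Bias and risk for Gaussian pairs\<close>

text \<open>A common bound for the three coefficients of the quadratic log-ratio of a pair of Gaussians in dimension
  \<open>d\<close> with parameters bounded by \<open>M\<close>.\<close>

definition coeff_bound :: "nat \<Rightarrow> real \<Rightarrow> real" where
  "coeff_bound d M = 2 * M ^ 3 + real d * M"

text \<open>The factor with which the log-ratio is dominated by \<open>exp (norm (x - m)\<^sup>2 / (8 \<sigma>\<^sup>2))\<close>.\<close>

definition growth_bound :: "nat \<Rightarrow> real \<Rightarrow> real" where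
  "growth_bound d M = coeff_bound d M * (32 * M + 4 * M\<^sup>2 + 2)"

lemma coeff_bound_ge_1: "1 < M \<Longrightarrow> 1 \<le> coeff_bound d M"
proof -
  assume M: "1 < M"
  then have "1 \<le> M ^ 3" by (intro one_le_power) auto
  moreover have "0 \<le> real d * M" using M by simp
  ultimately show ?thesis unfolding coeff_bound_def by linarith
qed

lemma growth_bound_nonneg: "1 < M \<Longrightarrow> 0 \<le> growth_bound d M"
  unfolding growth_bound_def using coeff_bound_ge_1[of M d] by (intro mult_nonneg_nonneg) auto

context
  fixes M \<sigma>p \<sigma>q :: real and mp mq :: "real ^ 'n"
  assumes M: "1 < M" and mp: "norm mp \<le> M" and mq: "norm mq \<le> M"
    and \<sigma>p: "0 < \<sigma>p" "\<sigma>p\<^sup>2 < M" "inverse (\<sigma>p\<^sup>2) < M"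
    and \<sigma>q: "0 < \<sigma>q" "\<sigma>q\<^sup>2 < M" "inverse (\<sigma>q\<^sup>2) < M"
begin

lemma gauss_density_pair: "density_pair lborel (gauss_density mp \<sigma>p) (gauss_density mq \<sigma>q)"
proof (intro density_pair.intro density_pair_axioms.intro)
  show "sigma_finite_measure lborel" by (rule sigma_finite_lborel)
  show "gauss_density mp \<sigma>p \<in> borel_measurable lborel" "gauss_density mq \<sigma>q \<in> borel_measurable lborel"
    using gauss_density_measurable by simp_all
  show "0 < gauss_density mp \<sigma>p x" "0 < gauss_density mq \<sigma>q x" for x
    by (rule gauss_density_pos, rule \<sigma>p \<sigma>q)+
  show "prob_space (density lborel (gauss_density mp \<sigma>p))" "prob_space (density lborel (gauss_density mq \<sigma>q))"
    unfolding isotropic_gaussian_eq_density[symmetric] by (rule prob_space_isotropic_gaussian, rule \<sigma>p \<sigma>q)+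
qed

interpretation density_pair lborel "gauss_density mp \<sigma>p" "gauss_density mq \<sigma>q"
  by (rule gauss_density_pair)

lemma log_ratio_quadratic:
  obtains \<alpha> \<kappa> and v :: "real ^ 'n"
  where "\<And>x. log_ratio x = \<alpha> * (norm x)\<^sup>2 + v \<bullet> x + \<kappa>"
    "\<bar>\<alpha>\<bar> \<le> coeff_bound CARD('n) M" "norm v \<le> coeff_bound CARD('n) M" "\<bar>\<kappa>\<bar> \<le> coeff_bound CARD('n) M"
proof (rule that)
  let ?sp = "inverse (\<sigma>p\<^sup>2)" and ?sq = "inverse (\<sigma>q\<^sup>2)" and ?d = "real CARD('n)"
  have s: "0 < ?sp" "?sp < M" "0 < ?sq" "?sq < M" using \<sigma>p \<sigma>q by auto
  have M23: "M \<le> M ^ 3" "M\<^sup>2 \<le> M ^ 3" using M by (auto intro: self_le_power power_increasing)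
  have dM: "0 \<le> ?d * M" "0 \<le> M ^ 3" using M by auto
  show "log_ratio x = (?sq - ?sp) / 2 * (norm x)\<^sup>2 + (?sp *\<^sub>R mp - ?sq *\<^sub>R mq) \<bullet> x
      + (?sq * (norm mq)\<^sup>2 / 2 - ?sp * (norm mp)\<^sup>2 / 2 + ?d / 2 * (ln (\<sigma>q\<^sup>2) - ln (\<sigma>p\<^sup>2)))" for x
    unfolding log_ratio_def by (rule gauss_log_ratio[OF \<sigma>p(1) \<sigma>q(1)])
  have half: "\<bar>(y - x) / 2\<bar> \<le> M" if "0 < x" "x < M" "0 < y" "y < M" for x y :: real
    using that unfolding abs_le_iff by (simp add: field_simps)
  have "\<bar>(?sq - ?sp) / 2\<bar> \<le> M" by (rule half[OF s])
  then show "\<bar>(?sq - ?sp) / 2\<bar> \<le> coeff_bound CARD('n) M" unfolding coeff_bound_def using M23 dM by linarith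
  have "norm (?sp *\<^sub>R mp - ?sq *\<^sub>R mq) \<le> ?sp * norm mp + ?sq * norm mq"
    using norm_triangle_ineq4[of "?sp *\<^sub>R mp" "?sq *\<^sub>R mq"] s by simp
  also have "\<dots> \<le> M * M + M * M" using s mp mq M by (intro add_mono mult_mono) auto
  also have "M * M + M * M \<le> coeff_bound CARD('n) M"
    unfolding coeff_bound_def using M23(2)[unfolded power2_eq_square] dM by linarith
  finally show "norm (?sp *\<^sub>R mp - ?sq *\<^sub>R mq) \<le> coeff_bound CARD('n) M" .
  have quad: "0 \<le> c * (norm w)\<^sup>2 / 2 \<and> c * (norm w)\<^sup>2 / 2 \<le> M ^ 3" if "0 < c" "c < M" "norm w \<le> M" for c and w :: "real ^ 'n"
  proof -
    have "c * (norm w)\<^sup>2 \<le> M * M\<^sup>2" using that by (intro mult_mono power_mono) auto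
    also have "\<dots> = M ^ 3" by (simp add: power2_eq_square power3_eq_cube)
    finally have "c * (norm w)\<^sup>2 \<le> M ^ 3" .
    moreover have "0 \<le> c * (norm w)\<^sup>2" using that by simp
    ultimately show ?thesis by linarith
  qed
  have lns: "\<bar>ln (\<sigma>\<^sup>2)\<bar> \<le> M" if "0 < \<sigma>" "\<sigma>\<^sup>2 < M" "inverse (\<sigma>\<^sup>2) < M" for \<sigma> :: real
  proof -
    have "ln (\<sigma>\<^sup>2) < ln M" using that M by (subst ln_less_cancel_iff) auto
    moreover have "ln (inverse (\<sigma>\<^sup>2)) < ln M" using that M by (subst ln_less_cancel_iff) auto
    moreover have "ln M \<le> M" using ln_le_minus_one[of M] M by linarith
    moreover have "ln (inverse (\<sigma>\<^sup>2)) = - ln (\<sigma>\<^sup>2)" using that by (intro ln_inverse)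
    ultimately show ?thesis by linarith
  qed
  have "\<bar>?d / 2 * (ln (\<sigma>q\<^sup>2) - ln (\<sigma>p\<^sup>2))\<bar> = ?d / 2 * \<bar>ln (\<sigma>q\<^sup>2) - ln (\<sigma>p\<^sup>2)\<bar>" by (simp add: abs_mult)
  also have "\<dots> \<le> ?d / 2 * (M + M)" using lns[OF \<sigma>p] lns[OF \<sigma>q] by (intro mult_left_mono) linarith+
  finally have "\<bar>?d / 2 * (ln (\<sigma>q\<^sup>2) - ln (\<sigma>p\<^sup>2))\<bar> \<le> ?d * M" by simp
  then show "\<bar>?sq * (norm mq)\<^sup>2 / 2 - ?sp * (norm mp)\<^sup>2 / 2 + ?d / 2 * (ln (\<sigma>q\<^sup>2) - ln (\<sigma>p\<^sup>2))\<bar> \<le> coeff_bound CARD('n) M"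
    unfolding coeff_bound_def using quad[OF s(1,2) mp] quad[OF s(3,4) mq] dM by linarith
qed

lemma log_ratio_growth:
  "\<bar>log_ratio x\<bar> \<le> growth_bound CARD('n) M * exp ((norm (x - mp))\<^sup>2 / (8 * \<sigma>p\<^sup>2))"
proof -
  let ?K = "coeff_bound CARD('n) M"
  have K: "1 \<le> ?K" using M by (rule coeff_bound_ge_1)
  obtain \<alpha> \<kappa> and v :: "real ^ 'n" where f: "\<And>x. log_ratio x = \<alpha> * (norm x)\<^sup>2 + v \<bullet> x + \<kappa>"
    and bd: "\<bar>\<alpha>\<bar> \<le> ?K" "norm v \<le> ?K" "\<bar>\<kappa>\<bar> \<le> ?K"
    by (rule log_ratio_quadratic) blast
  define y where "y = norm (x - mp)"
  define z where "z = y\<^sup>2 / (8 * \<sigma>p\<^sup>2)"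
  have s2: "0 < \<sigma>p\<^sup>2" using \<sigma>p by simp
  have z0: "0 \<le> z" using s2 by (simp add: z_def)
  have "norm x \<le> y + M" using norm_triangle_ineq2[of x mp] mp by (simp add: y_def)
  then have "(norm x)\<^sup>2 \<le> (y + M)\<^sup>2" by (intro power_mono) auto
  also have "\<dots> \<le> 2 * y\<^sup>2 + 2 * M\<^sup>2"
    using sum_squares_bound[of y M] by (simp add: power2_sum)
  finally have nx: "(norm x)\<^sup>2 \<le> 2 * y\<^sup>2 + 2 * M\<^sup>2" .
  have "y\<^sup>2 = 8 * \<sigma>p\<^sup>2 * z" using s2 by (simp add: z_def)
  also have "\<dots> \<le> 8 * M * z" using \<sigma>p z0 by (intro mult_right_mono) auto
  finally have y2: "y\<^sup>2 \<le> 8 * M * z" .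
  have x1: "norm x \<le> 1 + (norm x)\<^sup>2"
    using sum_squares_bound[of "norm x" 1] by (simp add: power2_eq_square) (smt (verit) zero_le_square norm_ge_zero)
  have "\<bar>log_ratio x\<bar> \<le> \<bar>\<alpha> * (norm x)\<^sup>2\<bar> + \<bar>v \<bullet> x\<bar> + \<bar>\<kappa>\<bar>" unfolding f by linarith
  also have "\<dots> \<le> ?K * (norm x)\<^sup>2 + ?K * norm x + ?K"
  proof (intro add_mono bd)
    show "\<bar>\<alpha> * (norm x)\<^sup>2\<bar> \<le> ?K * (norm x)\<^sup>2" using bd by (simp add: abs_mult mult_right_mono)
    show "\<bar>v \<bullet> x\<bar> \<le> ?K * norm x"
      using Cauchy_Schwarz_ineq2[of v x] mult_right_mono[OF bd(2) norm_ge_zero[of x]] by linarith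
  qed
  also have "\<dots> = ?K * ((norm x)\<^sup>2 + norm x + 1)" by (simp add: algebra_simps)
  also have "\<dots> \<le> ?K * (32 * M * z + 4 * M\<^sup>2 + 2)"
    using K nx y2 x1 by (intro mult_left_mono) linarith+
  also have "\<dots> \<le> ?K * ((32 * M + 4 * M\<^sup>2 + 2) * (1 + z))"
  proof (intro mult_left_mono)
    have "0 \<le> 32 * M + (4 * M\<^sup>2 + 2) * z" using M z0 by (intro add_nonneg_nonneg mult_nonneg_nonneg) auto
    then show "32 * M * z + 4 * M\<^sup>2 + 2 \<le> (32 * M + 4 * M\<^sup>2 + 2) * (1 + z)" by (simp add: algebra_simps)
  qed (use K in auto)
  also have "\<dots> \<le> ?K * ((32 * M + 4 * M\<^sup>2 + 2) * exp z)"
    using K M exp_ge_add_one_self[of z] by (intro mult_left_mono) auto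
  finally show ?thesis unfolding growth_bound_def z_def y_def by (simp only: mult.assoc)
qed

lemma integrable_log_ratio: "integrable P log_ratio"
proof (rule Bochner_Integration.integrable_bound)
  let ?h = "\<lambda>x. growth_bound CARD('n) M * exp (3 * (norm (x - mp))\<^sup>2 / (8 * \<sigma>p\<^sup>2))"
  show "integrable P ?h"
    using integrable_mult_right[OF gauss_square_exp_moment(1)[OF \<sigma>p(1), of mp]]
    unfolding isotropic_gaussian_eq_density .
  show "log_ratio \<in> borel_measurable P" using log_ratio_measurable by simp
  have "\<bar>log_ratio x\<bar> \<le> ?h x" for x
  proof -
    have "(norm (x - mp))\<^sup>2 / (8 * \<sigma>p\<^sup>2) \<le> 3 * (norm (x - mp))\<^sup>2 / (8 * \<sigma>p\<^sup>2)" by (intro divide_right_mono) auto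
    then have "growth_bound CARD('n) M * exp ((norm (x - mp))\<^sup>2 / (8 * \<sigma>p\<^sup>2)) \<le> ?h x"
      using growth_bound_nonneg[OF M, of "CARD('n)"] by (intro mult_left_mono) auto
    then show ?thesis using log_ratio_growth[of x] by linarith
  qed
  then show "AE x in P. norm (log_ratio x) \<le> norm (?h x)"
    using growth_bound_nonneg[OF M, of "CARD('n)"] by (intro AE_I2) (simp add: abs_mult)
qed

lemma gauss_net_bias:
  assumes k: "1 \<le> k" and t: "0 \<le> t" and a: "4 * real CARD('n) * coeff_bound CARD('n) M * (M + t)\<^sup>2 \<le> a"
  defines "\<epsilon> \<equiv> 8 * (real CARD('n))\<^sup>2 * coeff_bound CARD('n) M * (M + t)\<^sup>2 / real k"
  shows "\<exists>g\<in>truncated_relu_nets k a (M + t). KL P Q - objective g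
    \<le> \<epsilon> * exp \<epsilon> + (growth_bound CARD('n) M + 1) * exp (- t\<^sup>2 / (4 * M)) * 2 ^ CARD('n)"
proof -
  let ?K = "coeff_bound CARD('n) M" and ?R = "M + t" and ?A = "growth_bound CARD('n) M"
  have K: "1 \<le> ?K" using M by (rule coeff_bound_ge_1)
  have R: "1 \<le> ?R" using M t by simp
  obtain \<alpha> \<kappa> and v :: "real ^ 'n" where f: "\<And>x. log_ratio x = \<alpha> * (norm x)\<^sup>2 + v \<bullet> x + \<kappa>"
    and bd: "\<bar>\<alpha>\<bar> \<le> ?K" "norm v \<le> ?K" "\<bar>\<kappa>\<bar> \<le> ?K"
    by (rule log_ratio_quadratic) blast
  obtain g where g: "g \<in> truncated_relu_nets k a ?R" and near: "\<And>x. x \<in> cball 0 ?R \<Longrightarrow> \<bar>g x - log_ratio x\<bar> \<le> \<epsilon>"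
    using quadratic_relu_approx[OF bd R k a] unfolding f \<epsilon>_def by blast
  have a0: "0 < a"
  proof -
    have "0 < 4 * real CARD('n) * ?K * ?R\<^sup>2" using K R by simp
    then show ?thesis using a by linarith
  qed
  have \<epsilon>0: "0 \<le> \<epsilon>" unfolding \<epsilon>_def using K by simp
  have off: "g x = 0" if "x \<notin> cball 0 ?R" for x
  proof -
    obtain h where "g = (\<lambda>x. h x * indicator (cball 0 ?R) x)" using g unfolding truncated_relu_nets_def by blast
    then show ?thesis using that by simp
  qed
  have R0: "0 \<le> ?R" using R by simp
  have "KL P Q - objective g \<le> \<epsilon> * exp \<epsilon>
     + (\<integral>x. \<bar>log_ratio x\<bar> * indicator (- cball 0 ?R) x \<partial>P) + (\<integral>x. indicator (- cball 0 ?R) x \<partial>Q)"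
  proof (rule KL_minus_objective_le[OF integrable_log_ratio _ _ _ near off \<epsilon>0])
    show "g \<in> borel_measurable lborel" using truncated_relu_net_measurable[OF g a0 k] by simp
    show "\<bar>g x\<bar> \<le> net_bound TYPE('n) a ?R" for x by (rule truncated_relu_net_abs_le[OF g a0 k R0])
  qed auto
  also have "(\<integral>x. \<bar>log_ratio x\<bar> * indicator (- cball 0 ?R) x \<partial>P) \<le> ?A * exp (- t\<^sup>2 / (4 * M)) * 2 ^ CARD('n)"
    using gauss_tail_integral[OF \<sigma>p(1,2) mp t growth_bound_nonneg[OF M] log_ratio_growth]
    unfolding isotropic_gaussian_eq_density .
  also have "(\<integral>x. indicator (- cball 0 ?R) x \<partial>Q) \<le> 1 * exp (- t\<^sup>2 / (4 * M)) * 2 ^ CARD('n)"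
    using gauss_tail_integral[OF \<sigma>q(1,2) mq t, of 1 "\<lambda>_. 1"]
    unfolding isotropic_gaussian_eq_density by simp
  finally show ?thesis using g by (intro bexI[of _ g]) (auto simp: algebra_simps)
qed

lemma gauss_estimator_risk:
  assumes n: "1 \<le> n" and k: "1 \<le> k" and t: "0 \<le> t"
    and a: "4 * real CARD('n) * coeff_bound CARD('n) M * (M + t)\<^sup>2 \<le> a"
  defines "\<epsilon> \<equiv> 8 * (real CARD('n))\<^sup>2 * coeff_bound CARD('n) M * (M + t)\<^sup>2 / real k"
  defines "\<Lambda> \<equiv> net_bound TYPE('n) a (M + t)"
  shows "(\<integral>\<^sup>+ (X, Y). ennreal \<bar>KL_estimator (truncated_relu_nets k a (M + t)) n X Y
        - KL (isotropic_gaussian mp \<sigma>p) (isotropic_gaussian mq \<sigma>q)\<bar>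
      \<partial>sample_law n (isotropic_gaussian mp \<sigma>p) (isotropic_gaussian mq \<sigma>q))
    \<le> ennreal (\<epsilon> * exp \<epsilon> + (growth_bound CARD('n) M + 1) * exp (- t\<^sup>2 / (4 * M)) * 2 ^ CARD('n)
        + 40 * (exp \<Lambda> * \<Lambda>) * sqrt (net_entropy TYPE('n) k / real n))"
proof -
  obtain g where g: "g \<in> truncated_relu_nets k a (M + t)" "KL P Q - objective g
    \<le> \<epsilon> * exp \<epsilon> + (growth_bound CARD('n) M + 1) * exp (- t\<^sup>2 / (4 * M)) * 2 ^ CARD('n)"
    using gauss_net_bias[OF k t a] unfolding \<epsilon>_def by blast
  have "0 < 4 * real CARD('n) * coeff_bound CARD('n) M * (M + t)\<^sup>2"
    using coeff_bound_ge_1[OF M, of "CARD('n)"] M t by simp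
  then have a0: "0 < a" using a by linarith
  have R0: "0 \<le> M + t" using M t by simp
  show ?thesis
    unfolding isotropic_gaussian_eq_density \<Lambda>_def
    by (rule KL_estimator_risk[OF gauss_density_pair _ n k a0 R0 integrable_log_ratio g]) simp
qed

end

section \<open>Choice of the constants\<close>

text \<open>Since \<open>ln k\<close> stays above \<open>b = ln 2\<close>, lower powers of it are absorbed by higher ones.\<close>

lemma powr_le_powr_lower:
  fixes l :: real
  assumes "0 < b" "b \<le> l" "e \<le> q"
  shows "l powr e \<le> b powr (e - q) * l powr q"
proof -
  have "b powr (q - e) \<le> l powr (q - e)" using assms by (intro powr_mono2) auto
  then have "l powr e * b powr (q - e) \<le> l powr e * l powr (q - e)" by (intro mult_left_mono) auto
  then have "l powr e * b powr (q - e) \<le> l powr q" by (simp add: powr_add[symmetric])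
  then have "b powr (e - q) * (l powr e * b powr (q - e)) \<le> b powr (e - q) * l powr q" by (intro mult_left_mono) auto
  moreover have "b powr (e - q) * b powr (q - e) = 1" using assms by (simp add: powr_add[symmetric])
  ultimately show ?thesis by (simp add: mult.left_commute)
qed

lemma ln_le_self_real: "0 < x \<Longrightarrow> ln x \<le> (x :: real)"
  using ln_le_minus_one[of x] by linarith

text \<open>With \<open>l = ln k\<close>, the radius is at most \<open>\<rho> * sqrt l\<close>, hence the scale \<open>m\<close> required by the approximation
  is of order \<open>l\<close> and \<open>c' * l powr ((d + 3) / 2)\<close> suffices. Then \<open>\<Lambda> \<le> \<theta> * l powr q\<close> with
  \<open>q = (d + 4) / 2\<close>, and \<open>\<Lambda> * exp \<Lambda> * sqrt k \<le> exp (c * l powr q)\<close>. The argument \<open>A\<close> stands for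
  the Gaussian tail constant and \<open>h\<close> for the entropy
  constant \<open>3 * (2 d + 3)\<close> of the covers per neuron.\<close>

lemma gauss_risk_rate:
  fixes M d K A h :: real
  assumes M: "1 < M" and d: "1 \<le> d" and K: "1 \<le> K" and A: "0 \<le> A" and h: "0 < h"
  shows "\<exists>c>0. \<exists>c'>0. \<exists>c''>0. \<exists>C>0. \<forall>k n :: nat. 2 \<le> k \<longrightarrow> 1 \<le> n \<longrightarrow>
    (let l = ln (real k); m = c' * l powr ((d + 3) / 2); t = c'' * sqrt l;
         \<epsilon> = 8 * d\<^sup>2 * K * (M + t)\<^sup>2 / real k; \<Lambda> = 5 * m * (d * (M + t) + 1)
     in 4 * d * K * (M + t)\<^sup>2 \<le> m \<and> 0 \<le> t \<and>
        \<epsilon> * exp \<epsilon> + A * exp (- t\<^sup>2 / (4 * M)) + 40 * (exp \<Lambda> * \<Lambda>) * sqrt (h * real k / real n)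
        \<le> C * l powr ((d + 4) / 2) *
           (real k powr (- 1 / 2) + real k powr (c * l powr ((d + 2) / 2)) * real n powr (- 1 / 2)))"
proof -
  define b where "b = ln (2 :: real)"
  define q where "q = (d + 4) / 2"
  \<comment> \<open>makes \<open>exp (- t\<^sup>2 / (4 M))\<close> equal to \<open>k powr (- 1 / 2)\<close>\<close>
  define c'' where "c'' = sqrt (2 * M)"
  define \<rho> where "\<rho> = M / sqrt b + c''"
  define c' where "c' = 4 * d * K * \<rho>\<^sup>2 * b powr (1 - (d + 3) / 2)"
  define \<theta> where "\<theta> = 10 * d * c' * \<rho>"
  define c where "c = 2 * \<theta> + b powr (1 - q)"
  \<comment> \<open>bounds \<open>\<epsilon>\<close> for every \<open>k\<close>, by \<open>ln k \<le> k\<close>\<close>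
  define e where "e = 8 * d\<^sup>2 * K * \<rho>\<^sup>2"
  define C1 where "C1 = e * exp e * b powr (1 - q) + A * b powr (0 - q)"
  define C2 where "C2 = 40 * sqrt h * b powr (0 - q)"
  have b: "0 < b" by (simp add: b_def)
  have c'': "0 < c''" using M by (simp add: c''_def)
  have \<rho>: "0 < \<rho>" unfolding \<rho>_def using M b c'' by (intro add_pos_pos divide_pos_pos) auto
  have c': "0 < c'" unfolding c'_def using d K \<rho> b by (intro mult_pos_pos) auto
  have \<theta>: "0 < \<theta>" unfolding \<theta>_def using d c' \<rho> by (intro mult_pos_pos) auto
  have c: "0 < c" unfolding c_def using \<theta> b by (intro add_pos_pos mult_pos_pos) auto
  have e: "0 < e" unfolding e_def using d K \<rho> by (intro mult_pos_pos) auto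
  have C1: "0 < C1" unfolding C1_def using e A b by (intro add_pos_nonneg mult_pos_pos mult_nonneg_nonneg) auto
  have C2: "0 < C2" unfolding C2_def using h b by (intro mult_pos_pos) auto
  have "4 * d * K * (M + t)\<^sup>2 \<le> m \<and> 0 \<le> t \<and>
        \<epsilon> * exp \<epsilon> + A * exp (- t\<^sup>2 / (4 * M)) + 40 * (exp \<Lambda> * \<Lambda>) * sqrt (h * real k / real n)
        \<le> (C1 + C2) * l powr q *
           (real k powr (- 1 / 2) + real k powr (c * l powr ((d + 2) / 2)) * real n powr (- 1 / 2))"
    if k: "2 \<le> k" and n: "1 \<le> n" and l: "l = ln (real k)" and m: "m = c' * l powr ((d + 3) / 2)"
      and t: "t = c'' * sqrt l" and \<epsilon>: "\<epsilon> = 8 * d\<^sup>2 * K * (M + t)\<^sup>2 / real k"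
      and \<Lambda>: "\<Lambda> = 5 * m * (d * (M + t) + 1)"
    for k n :: nat and l m t \<epsilon> \<Lambda> :: real
  proof (intro conjI)
    have bl: "b \<le> l" unfolding b_def l using k by (subst ln_le_cancel_iff) auto
    have l0: "0 < l" using b bl by linarith
    have lk: "l \<le> real k" unfolding l using k by (intro ln_le_self_real) auto
    have ek: "real k = exp l" unfolding l using k by simp
    show t0: "0 \<le> t" using c'' l0 by (simp add: t)
    have R1: "1 \<le> M + t" using M t0 by linarith
    have R: "M + t \<le> \<rho> * sqrt l"
    proof -
      have "M * sqrt b \<le> M * sqrt l" using M bl by (intro mult_left_mono) auto
      then have "M \<le> M / sqrt b * sqrt l" using b by (simp add: field_simps)
      then show ?thesis by (simp add: \<rho>_def t algebra_simps)
    qed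
    have R2: "(M + t)\<^sup>2 \<le> \<rho>\<^sup>2 * l"
    proof -
      have "(M + t)\<^sup>2 \<le> (\<rho> * sqrt l)\<^sup>2" using R R1 by (intro power_mono) auto
      then show ?thesis using l0 by (simp add: power_mult_distrib)
    qed
    have lin: "l \<le> b powr (1 - p) * l powr p" if "1 \<le> p" for p
      using powr_le_powr_lower[OF b bl that] l0 by simp
    show "4 * d * K * (M + t)\<^sup>2 \<le> m"
    proof -
      have "4 * d * K * (M + t)\<^sup>2 \<le> 4 * d * K * (\<rho>\<^sup>2 * l)" using R2 d K by (intro mult_left_mono) auto
      also have "\<dots> \<le> 4 * d * K * (\<rho>\<^sup>2 * (b powr (1 - (d + 3) / 2) * l powr ((d + 3) / 2)))"
        using lin[of "(d + 3) / 2"] d K by (intro mult_left_mono) auto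
      also have "\<dots> = m" by (simp only: m c'_def mult_ac)
      finally show ?thesis .
    qed
    have m0: "0 < m" using c' l0 by (simp add: m)
    have q1: "1 \<le> q" using d by (simp add: q_def)
    have \<Lambda>0: "0 \<le> \<Lambda>" unfolding \<Lambda> using m0 d R1 by simp
    have \<Lambda>_le: "\<Lambda> \<le> \<theta> * l powr q"
    proof -
      have "1 * 1 \<le> d * (M + t)" using d R1 by (intro mult_mono) auto
      then have "\<Lambda> \<le> 5 * m * (2 * (d * (M + t)))" unfolding \<Lambda> using m0 by (intro mult_left_mono) auto
      also have "\<dots> \<le> 5 * m * (2 * (d * (\<rho> * sqrt l)))" using m0 d R by (intro mult_left_mono) auto
      also have "\<dots> = \<theta> * (l powr ((d + 3) / 2) * sqrt l)" by (simp add: m \<theta>_def mult_ac)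
      also have "l powr ((d + 3) / 2) * sqrt l = l powr q"
      proof -
        have "(d + 3) / 2 + 1 / 2 = q" by (simp add: q_def field_simps)
        moreover have "sqrt l = l powr (1 / 2)" using l0 by (simp add: powr_half_sqrt)
        ultimately show ?thesis by (simp only: powr_add[symmetric])
      qed
      finally show ?thesis .
    qed
    have \<epsilon>0: "0 \<le> \<epsilon>" unfolding \<epsilon> using d K by simp
    have \<epsilon>1: "\<epsilon> \<le> e * (l / real k)"
    proof -
      have "\<epsilon> \<le> 8 * d\<^sup>2 * K * (\<rho>\<^sup>2 * l) / real k"
        unfolding \<epsilon> using R2 d K by (intro divide_right_mono mult_left_mono) auto
      then show ?thesis by (simp add: e_def mult_ac)
    qed
    also have "\<dots> \<le> e * 1" using e lk k by (intro mult_left_mono) auto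
    finally have \<epsilon>2: "\<epsilon> \<le> e" by simp
    have kk: "1 / real k \<le> real k powr (- 1 / 2)"
    proof -
      have "1 / real k = real k powr - 1" using k by (intro powr_neg_one[symmetric]) simp
      also have "\<dots> \<le> real k powr (- 1 / 2)" using k by (intro powr_mono) auto
      finally show ?thesis .
    qed
    have "\<epsilon> * exp \<epsilon> \<le> (e * (l / real k)) * exp e" using \<epsilon>0 \<epsilon>1 \<epsilon>2 by (intro mult_mono) auto
    also have "\<dots> = e * exp e * (l * (1 / real k))" by simp
    also have "\<dots> \<le> e * exp e * ((b powr (1 - q) * l powr q) * real k powr (- 1 / 2))"
      using e lin[OF q1] kk l0 by (intro mult_left_mono mult_mono) auto
    finally have bias: "\<epsilon> * exp \<epsilon> \<le> (e * exp e * b powr (1 - q)) * l powr q * real k powr (- 1 / 2)"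
      by (simp add: mult_ac)
    have one: "1 \<le> b powr (0 - q) * l powr q"
      using powr_le_powr_lower[OF b bl, of 0 q] q1 l0 by simp
    have "exp (- t\<^sup>2 / (4 * M)) = real k powr (- 1 / 2)"
    proof -
      have "t\<^sup>2 = 2 * M * l" using M l0 by (simp add: t c''_def power_mult_distrib)
      then have "- t\<^sup>2 / (4 * M) = - 1 / 2 * l" using M by simp
      then show ?thesis using k by (simp add: powr_def l)
    qed
    then have "A * exp (- t\<^sup>2 / (4 * M)) \<le> A * ((b powr (0 - q) * l powr q) * real k powr (- 1 / 2))"
      using A mult_right_mono[OF one, of "real k powr (- 1 / 2)"] by (intro mult_left_mono) auto
    then have tail: "A * exp (- t\<^sup>2 / (4 * M)) \<le> (A * b powr (0 - q)) * l powr q * real k powr (- 1 / 2)"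
      by (simp add: mult_ac)
    have kc: "exp (c * l powr q) = real k powr (c * l powr ((d + 2) / 2))"
    proof -
      have "l powr q = l powr ((d + 2) / 2) * l"
      proof -
        have "q = (d + 2) / 2 + 1" by (simp add: q_def field_simps)
        then show ?thesis using l0 by (simp only: powr_add powr_one)
      qed
      then show ?thesis using k by (simp add: powr_def[of "real k"] l mult_ac)
    qed
    have "exp \<Lambda> * \<Lambda> * sqrt (real k) \<le> exp (\<theta> * l powr q) * exp (\<theta> * l powr q) * exp (b powr (1 - q) * l powr q)"
    proof (intro mult_mono)
      show "exp \<Lambda> \<le> exp (\<theta> * l powr q)" using \<Lambda>_le by simp
      show "\<Lambda> \<le> exp (\<theta> * l powr q)" using \<Lambda>_le exp_ge_add_one_self[of "\<theta> * l powr q"] by linarith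
      have "sqrt (real k) \<le> real k" using k real_sqrt_le_mono[of "real k" "(real k)\<^sup>2"] by (simp add: power2_eq_square)
      also have "\<dots> \<le> exp (b powr (1 - q) * l powr q)" unfolding ek using lin[OF q1] by simp
      finally show "sqrt (real k) \<le> exp (b powr (1 - q) * l powr q)" .
    qed (use \<Lambda>0 in auto)
    also have "\<dots> = exp (c * l powr q)" by (simp add: exp_add[symmetric] c_def algebra_simps)
    finally have size: "exp \<Lambda> * \<Lambda> * sqrt (real k) \<le> exp (c * l powr q)" .
    have "40 * (exp \<Lambda> * \<Lambda>) * sqrt (h * real k / real n) = 40 * sqrt h * (exp \<Lambda> * \<Lambda> * sqrt (real k)) * real n powr (- 1 / 2)"
    proof -
      have "real n powr (- 1 / 2) = 1 / sqrt (real n)"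
      proof -
        have "(- 1 / 2 :: real) = - (1 / 2)" by simp
        then show ?thesis by (simp only: powr_minus_divide powr_half_sqrt of_nat_0_le_iff)
      qed
      then show ?thesis by (simp add: real_sqrt_mult real_sqrt_divide)
    qed
    also have "\<dots> \<le> 40 * sqrt h * ((b powr (0 - q) * l powr q) * exp (c * l powr q)) * real n powr (- 1 / 2)"
      using h
      by (intro mult_right_mono mult_left_mono order_trans[OF size mult_right_mono[OF one, unfolded mult_1]]) auto
    finally have stat: "40 * (exp \<Lambda> * \<Lambda>) * sqrt (h * real k / real n)
      \<le> C2 * l powr q * (real k powr (c * l powr ((d + 2) / 2)) * real n powr (- 1 / 2))"
      unfolding kc C2_def by (simp add: mult_ac)
    have "\<epsilon> * exp \<epsilon> + A * exp (- t\<^sup>2 / (4 * M)) + 40 * (exp \<Lambda> * \<Lambda>) * sqrt (h * real k / real n)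
      \<le> C1 * l powr q * real k powr (- 1 / 2) + C2 * l powr q * (real k powr (c * l powr ((d + 2) / 2)) * real n powr (- 1 / 2))"
      using bias tail stat unfolding C1_def by (simp add: distrib_right)
    also have "\<dots> \<le> (C1 + C2) * l powr q * real k powr (- 1 / 2)
        + (C1 + C2) * l powr q * (real k powr (c * l powr ((d + 2) / 2)) * real n powr (- 1 / 2))"
      using C1 C2 by (intro add_mono mult_right_mono) auto
    finally show "\<epsilon> * exp \<epsilon> + A * exp (- t\<^sup>2 / (4 * M)) + 40 * (exp \<Lambda> * \<Lambda>) * sqrt (h * real k / real n)
      \<le> (C1 + C2) * l powr q * (real k powr (- 1 / 2) + real k powr (c * l powr ((d + 2) / 2)) * real n powr (- 1 / 2))"
      by (simp only: distrib_left)
  qed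
  note rate = this
  show ?thesis
    unfolding Let_def
    by (rule exI[of _ c], rule conjI[OF c], rule exI[of _ c'], rule conjI[OF c'], rule exI[of _ c''],
      rule conjI[OF c''], rule exI[of _ "C1 + C2"], rule conjI[OF add_pos_pos[OF C1 C2]], intro allI impI,
      rule rate[unfolded q_def, OF _ _ refl refl refl refl refl])
qed

theorem corollary41:
  fixes M :: real
  assumes "1 < M"
  shows "\<exists>c > 0. \<exists>c' > 0. \<exists>c'' > 0. \<exists>C > 0. \<forall>k::nat. \<forall>n::nat. 2 \<le> k \<longrightarrow> 1 \<le> n \<longrightarrow>
    (let d = real CARD('n);
         m = c' * ln (real k) powr ((d + 3) / 2);
         r = max 1 M + c'' * sqrt (ln (real k));
         G = truncated_relu_nets k m r
     in (SUP (\<mu>, \<nu>) \<in> gaussian_pairs M.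
           \<integral>\<^sup>+ (X, Y). ennreal \<bar>KL_estimator G n X Y - KL \<mu> (\<nu> :: (real ^ 'n) measure)\<bar> \<partial>sample_law n \<mu> \<nu>)
        \<le> ennreal (C * ln (real k) powr ((d + 4) / 2) *
             (real k powr (- 1 / 2) +
              real k powr (c * ln (real k) powr ((d + 2) / 2)) * real n powr (- 1 / 2))))"
proof -
  let ?d = "real CARD('n)" and ?K = "coeff_bound CARD('n) M"
  let ?A = "(growth_bound CARD('n) M + 1) * 2 ^ CARD('n)" and ?h = "3 * (2 * ?d + 3)"
  have d: "1 \<le> ?d" by (simp add: Suc_leI)
  have A: "0 \<le> ?A" using growth_bound_nonneg[OF assms, of "CARD('n)"] by simp
  have h: "0 < ?h" by simp
  obtain c c' c'' C where pos: "0 < c" "0 < c'" "0 < c''" "0 < C"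
    and rate: "\<And>k n :: nat. 2 \<le> k \<Longrightarrow> 1 \<le> n \<Longrightarrow>
      (let l = ln (real k); m = c' * l powr ((?d + 3) / 2); t = c'' * sqrt l;
         \<epsilon> = 8 * ?d\<^sup>2 * ?K * (M + t)\<^sup>2 / real k; \<Lambda> = 5 * m * (?d * (M + t) + 1)
     in 4 * ?d * ?K * (M + t)\<^sup>2 \<le> m \<and> 0 \<le> t \<and>
        \<epsilon> * exp \<epsilon> + ?A * exp (- t\<^sup>2 / (4 * M)) + 40 * (exp \<Lambda> * \<Lambda>) * sqrt (?h * real k / real n)
        \<le> C * l powr ((?d + 4) / 2) *
           (real k powr (- 1 / 2) + real k powr (c * l powr ((?d + 2) / 2)) * real n powr (- 1 / 2)))"
    using gauss_risk_rate[OF assms d coeff_bound_ge_1[OF assms] A h, of "CARD('n)"] by blast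
  have "(let d = real CARD('n);
         m = c' * ln (real k) powr ((d + 3) / 2);
         r = max 1 M + c'' * sqrt (ln (real k));
         G = truncated_relu_nets k m r
     in (SUP (\<mu>, \<nu>) \<in> gaussian_pairs M.
           \<integral>\<^sup>+ (X, Y). ennreal \<bar>KL_estimator G n X Y - KL \<mu> (\<nu> :: (real ^ 'n) measure)\<bar> \<partial>sample_law n \<mu> \<nu>)
        \<le> ennreal (C * ln (real k) powr ((d + 4) / 2) *
             (real k powr (- 1 / 2) +
              real k powr (c * ln (real k) powr ((d + 2) / 2)) * real n powr (- 1 / 2))))"
    if k: "2 \<le> k" and n: "1 \<le> n" for k n :: nat
  proof -
    define t where "t = c'' * sqrt (ln (real k))"
    define m where "m = c' * ln (real k) powr ((?d + 3) / 2)"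
    note bounds = rate[OF k n, unfolded Let_def, folded t_def m_def]
    have k1: "1 \<le> k" using k by simp
    have r: "max 1 M + c'' * sqrt (ln (real k)) = M + t" using assms by (simp add: t_def)
    show ?thesis
      unfolding Let_def r m_def[symmetric]
    proof (rule SUP_least)
      fix \<mu>\<nu> :: "(real ^ 'n) measure \<times> (real ^ 'n) measure"
      assume "\<mu>\<nu> \<in> gaussian_pairs M"
      then obtain mp \<sigma>p mq \<sigma>q where \<mu>\<nu>: "\<mu>\<nu> = (isotropic_gaussian mp \<sigma>p, isotropic_gaussian mq \<sigma>q)"
        and p: "norm mp \<le> M" "0 < \<sigma>p" "\<sigma>p\<^sup>2 < M" "inverse (\<sigma>p\<^sup>2) < M"
        and q: "norm mq \<le> M" "0 < \<sigma>q" "\<sigma>q\<^sup>2 < M" "inverse (\<sigma>q\<^sup>2) < M"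
        unfolding gaussian_pairs_def by blast
      show "(case \<mu>\<nu> of (\<mu>, \<nu>) \<Rightarrow> \<integral>\<^sup>+ (X, Y). ennreal \<bar>KL_estimator (truncated_relu_nets k m (M + t)) n X Y - KL \<mu> \<nu>\<bar> \<partial>sample_law n \<mu> \<nu>)
        \<le> ennreal (C * ln (real k) powr ((?d + 4) / 2) * (real k powr (- 1 / 2) + real k powr (c * ln (real k) powr ((?d + 2) / 2)) * real n powr (- 1 / 2)))"
        unfolding \<mu>\<nu> prod.case
      proof (rule order_trans[OF gauss_estimator_risk[OF assms p(1) q(1) p(2-4) q(2-4) n k1]])
        show "0 \<le> t" "4 * ?d * ?K * (M + t)\<^sup>2 \<le> m" using bounds by blast+
        show "ennreal (8 * ?d\<^sup>2 * ?K * (M + t)\<^sup>2 / real k * exp (8 * ?d\<^sup>2 * ?K * (M + t)\<^sup>2 / real k)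
            + (growth_bound CARD('n) M + 1) * exp (- t\<^sup>2 / (4 * M)) * 2 ^ CARD('n)
            + 40 * (exp (net_bound TYPE('n) m (M + t)) * net_bound TYPE('n) m (M + t)) * sqrt (net_entropy TYPE('n) k / real n))
          \<le> ennreal (C * ln (real k) powr ((?d + 4) / 2) * (real k powr (- 1 / 2) + real k powr (c * ln (real k) powr ((?d + 2) / 2)) * real n powr (- 1 / 2)))"
          using bounds unfolding net_bound_def net_entropy_def by (intro ennreal_leI) (simp only: mult_ac)
      qed
    qed
  qed
  then show ?thesis using pos by blast
qed

end
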